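(* For $0<H<\frac12$ let $X^H_t=e^tB^H_t-\int_0^te^sB^H_s\,ds$, $t\ge0$. As $H\downarrow0$, the finite-dimensional distributions of the process $X^H=\{X^H_t,\ t\ge0\}$ converge weakly to those of a Gaussian process $X^0=\{X^0_t,\ t\ge0\}$ with zero mean and covariance function $$\mathsf{R}^0(t,s)=\begin{cases}0, & t\wedge s=0,\\ \frac12, & t,s>0,\ t\ne s,\\ \frac12\left(1+e^{2t}\right), & t=s>0.\end{cases}$$
   Context: For $H\in(0,1)$, $B^H=\{B^H_t, t\ge 0\}$ is a fractional Brownian motion with Hurst index $H$: a zero-mean Gaussian process (with continuous paths) with covariance $\mathsf{E}B^H_tB^H_s=\frac12(t^{2H}+s^{2H}-|t-s|^{2H})$. Here $t\wedge s=\min(t,s)$. *)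

theory Defs
  imports "HOL-Probability.Probability"
begin

text \<open>The normal law with mean \<open>\<mu>\<close> and standard deviation \<open>\<sigma>\<close>; the degenerate case \<open>\<sigma> = 0\<close>
  (needed for vectors with a singular covariance matrix, e.g. at time 0) is the Dirac mass at \<open>\<mu>\<close>.\<close>

definition normal_law :: "real \<Rightarrow> real \<Rightarrow> real measure" where
  "normal_law \<mu> \<sigma> =
     (if \<sigma> = 0 then return borel \<mu> else density lborel (\<lambda>x. ennreal (normal_density \<mu> \<sigma> x)))"

text \<open>A process \<open>X t\<close>, \<open>t \<in> T\<close>, is Gaussian if all of its finite-dimensional distributions are
  multivariate normal, i.e. all finite linear combinations are normal random variables.\<close>

definition gaussian_process :: "'a measure \<Rightarrow> 't set \<Rightarrow> ('t \<Rightarrow> 'a \<Rightarrow> real) \<Rightarrow> bool" where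
  "gaussian_process M T X \<longleftrightarrow>
     prob_space M \<and>
     (\<forall>t\<in>T. X t \<in> borel_measurable M) \<and>
     (\<forall>J c. finite J \<and> J \<subseteq> T \<longrightarrow>
        (\<exists>\<mu> \<sigma>. \<sigma> \<ge> 0 \<and> distr M borel (\<lambda>\<omega>. \<Sum>t\<in>J. c t * X t \<omega>) = normal_law \<mu> \<sigma>))"

definition mean_fun :: "'a measure \<Rightarrow> ('t \<Rightarrow> 'a \<Rightarrow> real) \<Rightarrow> 't \<Rightarrow> real" where
  "mean_fun M X t = (\<integral>\<omega>. X t \<omega> \<partial>M)"

definition cov_fun :: "'a measure \<Rightarrow> ('t \<Rightarrow> 'a \<Rightarrow> real) \<Rightarrow> 't \<Rightarrow> 't \<Rightarrow> real" where
  "cov_fun M X t s = (\<integral>\<omega>. (X t \<omega> - mean_fun M X t) * (X s \<omega> - mean_fun M X s) \<partial>M)"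

definition fractional_brownian_motion ::
    "real \<Rightarrow> 'a measure \<Rightarrow> (real \<Rightarrow> 'a \<Rightarrow> real) \<Rightarrow> bool" where
  "fractional_brownian_motion H M B \<longleftrightarrow>
     0 < H \<and> H < 1 \<and>
     gaussian_process M {0..} B \<and>
     (\<forall>t\<ge>0. mean_fun M B t = 0) \<and>
     (\<forall>t\<ge>0. \<forall>s\<ge>0. cov_fun M B t s =
        (t powr (2 * H) + s powr (2 * H) - \<bar>t - s\<bar> powr (2 * H)) / 2) \<and>
     (\<forall>\<omega>\<in>space M. continuous_on {0..} (\<lambda>t. B t \<omega>))"

definition fidi :: "'a measure \<Rightarrow> ('t \<Rightarrow> 'a \<Rightarrow> real) \<Rightarrow> 't set \<Rightarrow> ('t \<Rightarrow> real) measure" where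
  "fidi M X J = distr M (PiM J (\<lambda>_. borel)) (\<lambda>\<omega>. \<lambda>t\<in>J. X t \<omega>)"

definition weak_conv_on ::
    "'a topology \<Rightarrow> ('i \<Rightarrow> 'a measure) \<Rightarrow> 'a measure \<Rightarrow> 'i filter \<Rightarrow> bool" where
  "weak_conv_on S \<mu> \<nu> F \<longleftrightarrow>
     (\<forall>f. continuous_map S euclideanreal f \<and> bounded (f ` topspace S) \<longrightarrow>
        ((\<lambda>i. \<integral>x. f x \<partial>\<mu> i) \<longlongrightarrow> (\<integral>x. f x \<partial>\<nu>)) F)"

text \<open>For finite \<open>J\<close>, the product topology on the extensional functions \<open>J \<rightarrow> \<real>\<close> is the usual
  topology of \<open>\<real>\<^sup>J\<close>. The processes may live on different probability spaces.\<close>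

definition fidi_weak_conv ::
    "'t set \<Rightarrow> ('i \<Rightarrow> 'a measure) \<Rightarrow> ('i \<Rightarrow> 't \<Rightarrow> 'a \<Rightarrow> real) \<Rightarrow>
     'b measure \<Rightarrow> ('t \<Rightarrow> 'b \<Rightarrow> real) \<Rightarrow> 'i filter \<Rightarrow> bool" where
  "fidi_weak_conv T M X M0 X0 F \<longleftrightarrow>
     (\<forall>J. finite J \<and> J \<subseteq> T \<longrightarrow>
        weak_conv_on (product_topology (\<lambda>_. euclideanreal) J)
          (\<lambda>i. fidi (M i) (X i) J) (fidi M0 X0 J) F)"

definition X_process :: "(real \<Rightarrow> 'a \<Rightarrow> real) \<Rightarrow> real \<Rightarrow> 'a \<Rightarrow> real" where
  "X_process B t \<omega> = exp t * B t \<omega> - integral {0..t} (\<lambda>s. exp s * B s \<omega>)"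

definition R0 :: "real \<Rightarrow> real \<Rightarrow> real" where
  "R0 t s = (if min t s = 0 then 0 else if t \<noteq> s then 1 / 2 else (1 + exp (2 * t)) / 2)"

end

theory Submission
  imports Defs
begin

text \<open>As \<open>H \<down> 0\<close> the covariance \<open>(t\<^bsup>2H\<^esup> + s\<^bsup>2H\<^esup> - |t - s|\<^bsup>2H\<^esup>) / 2\<close> of fractional Brownian motion tends, for
\<open>t, s > 0\<close>, to \<open>1/2\<close> if \<open>t \<noteq> s\<close> and to \<open>1\<close> if \<open>t = s\<close>. So \<open>B\<^sup>H\<close> degenerates to \<open>(\<xi>\<^sub>t + \<eta>) / \<surd>2\<close> with independent
standard normal variables \<open>\<eta>\<close> and \<open>\<xi>\<^sub>t\<close>. In \<open>e\<^sup>t B\<^sub>t - \<integral>\<^sub>0\<^sup>t e\<^sup>s B\<^sub>s ds\<close> the integral averages the white noise \<open>\<xi>\<close> away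
and cancels all but one copy of \<open>\<eta>\<close>, which suggests the limit \<open>(e\<^sup>t \<xi>\<^sub>t + \<eta>) / \<surd>2\<close> for \<open>t > 0\<close>. This process is
built on a product of standard normal laws and has the covariance \<open>R0\<close>.

Convergence in law is proved through cosine transforms. Approximating the integral by Riemann sums shows
that every linear combination of values of \<open>X\<^sup>H\<close> has the cosine transform of a centred normal law whose
variance is given by the double transform \<open>ibp t (\<lambda>u. ibp s (fbm_cov H u))\<close> of the covariance
(lemma \<open>X_process_cos\<close>). Dominated convergence, applied to each integral in turn, sends this
covariance to \<open>R0 t s\<close> (lemma \<open>X_process_cov_tendsto\<close>).

What turns this into weak convergence on \<open>\<real>\<^sup>J\<close> is theorem \<open>weak_conv_on_cosine\<close>, a continuity theorem in several
dimensions for laws with bounded second moments. It rests on a weighted Weierstrass theorem: a bounded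
continuous function differs from some finite trigonometric sum by at most \<open>\<epsilon> (1 + |x|\<^sup>2)\<close> at every point of \<open>\<real>\<^sup>J\<close>
(theorem \<open>weighted_trigonometric_approximation\<close>).\<close>

section \<open>Trigonometric approximation and weak convergence\<close>

text \<open>The phase \<open>\<theta>\<close> makes these the real and imaginary parts of all finite combinations of the characters
\<open>x \<mapsto> exp (\<i> c\<bullet>x)\<close> of \<open>\<real>\<^sup>J\<close>; a Gaussian law integrates each of them explicitly.\<close>
inductive_set trig_sums :: "'t set \<Rightarrow> (('t \<Rightarrow> real) \<Rightarrow> real) set" for J where
  wave: "(\<lambda>x. a * cos (\<theta> + (\<Sum>t\<in>J. c t * x t))) \<in> trig_sums J"
| add: "p \<in> trig_sums J \<Longrightarrow> q \<in> trig_sums J \<Longrightarrow> (\<lambda>x. p x + q x) \<in> trig_sums J"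

lemma trig_sums_const: "(\<lambda>x. a) \<in> trig_sums J"
  using trig_sums.wave[of a 0 "\<lambda>_. 0" J] by simp

lemma trig_sums_sin:
  assumes "finite J" "t \<in> J"
  shows "(\<lambda>x. sin (b * x t)) \<in> trig_sums J"
proof -
  have "(\<Sum>s\<in>J. (if s = t then b else 0) * x s) = b * x t" for x :: "'a \<Rightarrow> real"
    using assms by (simp add: if_distrib[of "\<lambda>u. u * _"] cong: if_cong)
  then show ?thesis
    using trig_sums.wave[of 1 "- pi / 2" "\<lambda>s. if s = t then b else 0" J]
    by (simp add: cos_diff)
qed

text \<open>The product formula for cosines turns a product of two waves into two waves whose frequencies are the
sum and the difference; this is what makes the trigonometric sums an algebra.\<close>
lemma trig_sums_mult:
  assumes "p \<in> trig_sums J" "q \<in> trig_sums J"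
  shows "(\<lambda>x. p x * q x) \<in> trig_sums J"
  using assms(1)
proof induction
  case (wave a \<theta> c)
  from assms(2) show ?case
  proof induction
    case (wave a' \<theta>' c')
    let ?A = "\<lambda>x. \<theta> + (\<Sum>t\<in>J. c t * x t)" and ?B = "\<lambda>x. \<theta>' + (\<Sum>t\<in>J. c' t * x t)"
    have eq: "(\<lambda>x. (a * cos (?A x)) * (a' * cos (?B x))) =
        (\<lambda>x. a * a' / 2 * cos ((\<theta> - \<theta>') + (\<Sum>t\<in>J. (c t - c' t) * x t)) +
             a * a' / 2 * cos ((\<theta> + \<theta>') + (\<Sum>t\<in>J. (c t + c' t) * x t)))"
    proof
      fix x
      have AB: "(\<theta> - \<theta>') + (\<Sum>t\<in>J. (c t - c' t) * x t) = ?A x - ?B x"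
        "(\<theta> + \<theta>') + (\<Sum>t\<in>J. (c t + c' t) * x t) = ?A x + ?B x"
        by (simp_all add: left_diff_distrib distrib_right sum_subtractf sum.distrib)
      have "(a * cos A) * (a' * cos B) = a * a' / 2 * cos (A - B) + a * a' / 2 * cos (A + B)"
        for A B :: real by (simp add: cos_diff cos_add field_simps)
      then show "(a * cos (?A x)) * (a' * cos (?B x)) =
        a * a' / 2 * cos ((\<theta> - \<theta>') + (\<Sum>t\<in>J. (c t - c' t) * x t)) +
             a * a' / 2 * cos ((\<theta> + \<theta>') + (\<Sum>t\<in>J. (c t + c' t) * x t))"
        by (simp only: AB)
    qed
    show ?case unfolding eq by (intro trig_sums.intros)
  qed (simp add: distrib_left trig_sums.add)
qed (simp add: distrib_right trig_sums.add)

lemma trig_sums_measurable: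
  "p \<in> trig_sums J \<Longrightarrow> p \<in> borel_measurable (PiM J (\<lambda>_. borel))"
  by (induction rule: trig_sums.induct) measurable

lemma trig_sums_bounded: "p \<in> trig_sums J \<Longrightarrow> \<exists>K. \<forall>x. \<bar>p x\<bar> \<le> K"
proof (induction rule: trig_sums.induct)
  case (wave a \<theta> c)
  have "\<bar>a * cos y\<bar> \<le> \<bar>a\<bar>" for y
    using abs_cos_le_one[of y] by (simp add: abs_mult mult_left_le)
  then show ?case by blast
next
  case (add p q)
  then obtain K L where "\<forall>x. \<bar>p x\<bar> \<le> K" "\<forall>x. \<bar>q x\<bar> \<le> L" by blast
  then have "\<bar>p x + q x\<bar> \<le> K + L" for x
    using abs_triangle_ineq[of "p x" "q x"] by (meson add_mono order_trans)
  then show ?case by blast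
qed

lemma compact_cube: "compact (J \<rightarrow>\<^sub>E {-1..1::real})"
proof -
  have eq: "(J \<rightarrow>\<^sub>E {-1..1::real}) = (\<Pi>\<^sub>E t\<in>UNIV. if t \<in> J then {-1..1} else {undefined})"
    by (auto simp: PiE_def Pi_def extensional_def split: if_splits)
  have "compactin (product_topology (\<lambda>_. euclideanreal) UNIV)
      (\<Pi>\<^sub>E t\<in>UNIV. if t \<in> J then {-1..1} else {undefined})"
    by (subst compactin_PiE) simp
  then show ?thesis
    by (simp add: eq euclidean_product_topology)
qed

text \<open>Characters are not dense in the bounded continuous functions for uniform convergence, but they are
if the error may grow like \<open>|x|\<^sup>2\<close>, which suffices against measures with bounded second moments.
Choose a cube of half-width \<open>R\<close>. The map \<open>x \<mapsto> arcsin (sin (b x)) / b\<close> with \<open>b = \<pi> / (2R)\<close> is the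
triangle wave that is the identity on \<open>[-R, R]\<close>, so composing \<open>f\<close> with it coordinatewise gives a
periodic function that agrees with \<open>f\<close> on the cube and is a continuous function of the
numbers \<open>sin (b x\<^sub>t)\<close> in \<open>[-1, 1]\<close>. By the Stone--Weierstrass theorem the latter is uniformly approximated
by polynomials in these sines, and they are trigonometric sums. Outside the cube \<open>f\<close> and its periodic
version differ by at most \<open>2K\<close>, and there \<open>|x|\<^sup>2 \<ge> R\<^sup>2\<close>; hence the condition \<open>2K \<le> \<epsilon>R\<^sup>2\<close>.\<close>
theorem weighted_trigonometric_approximation:
  assumes J: "finite J"
    and f: "continuous_map (product_topology (\<lambda>_. euclideanreal) J) euclideanreal f"
    and K: "\<And>x. x \<in> extensional J \<Longrightarrow> \<bar>f x\<bar> \<le> K"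
    and \<epsilon>: "\<epsilon> > 0"
  shows "\<exists>p\<in>trig_sums J. \<forall>x\<in>extensional J. \<bar>f x - p x\<bar> \<le> \<epsilon> * (1 + (\<Sum>t\<in>J. (x t)\<^sup>2))"
proof -
  have "K \<ge> 0" using K[of "\<lambda>t\<in>J. 0"] by force
  define R where "R = sqrt (2 * K / \<epsilon>) + 1"
  have R: "R > 0" "2 * K \<le> \<epsilon> * R\<^sup>2"
  proof -
    show "R > 0" using \<open>K \<ge> 0\<close> \<epsilon> by (simp add: R_def add_nonneg_pos)
    have "2 * K / \<epsilon> = (sqrt (2 * K / \<epsilon>))\<^sup>2" using \<open>K \<ge> 0\<close> \<epsilon> by simp
    also have "\<dots> \<le> R\<^sup>2" unfolding R_def using \<open>K \<ge> 0\<close> \<epsilon> by (intro power_mono) auto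
    finally show "2 * K \<le> \<epsilon> * R\<^sup>2" using \<epsilon> by (simp add: field_simps)
  qed
  define b where "b = pi / (2 * R)"
  have "b > 0" using R by (simp add: b_def)
  \<comment> \<open>The Stone--Weierstrass theorem needs a Hausdorff space as its type. Functions on a countable type
    form one, so the coordinates are relabelled by natural numbers.\<close>
  obtain h :: "'a \<Rightarrow> nat" where h: "inj_on h J"
    using finite_imp_inj_to_nat_seg[OF J] by blast
  define S where "S = (h ` J \<rightarrow>\<^sub>E {-1..1::real})"
  define g where "g y = f (\<lambda>t\<in>J. arcsin (y (h t)) / b)" for y
  define \<phi> where "\<phi> x = (\<lambda>i\<in>h ` J. sin (b * x (inv_into J h i)))" for x :: "'a \<Rightarrow> real"
  have "continuous_map (top_of_set S) (product_topology (\<lambda>_. euclideanreal) J)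
      (\<lambda>y. \<lambda>t\<in>J. arcsin (y (h t)) / b)"
    unfolding continuous_map_componentwise
  proof (intro conjI ballI)
    fix t assume "t \<in> J"
    then have "continuous_on S (\<lambda>y. arcsin (y (h t)) / b)"
      unfolding S_def using \<open>b > 0\<close>
      by (intro continuous_intros continuous_on_subset[OF continuous_on_product_coordinates])
         (force simp: PiE_def Pi_def)+
    then show "continuous_map (top_of_set S) euclideanreal (\<lambda>y. (\<lambda>t\<in>J. arcsin (y (h t)) / b) t)"
      using \<open>t \<in> J\<close> by simp
  qed (auto simp: extensional_def)
  from continuous_map_compose[OF this f] have g: "continuous_on S g"
    by (simp add: g_def[abs_def] o_def)
  define P where "P q \<longleftrightarrow> continuous_on S q \<and> (\<lambda>x. q (\<phi> x)) \<in> trig_sums J" for q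
  have coord: "P (\<lambda>y. y (h t))" if "t \<in> J" for t
    using trig_sums_sin[OF J that, of b] that
      continuous_on_subset[OF continuous_on_product_coordinates[of "h t"] subset_UNIV]
    by (simp add: P_def \<phi>_def h)
  have "\<exists>q. P q \<and> (\<forall>y\<in>S. \<bar>g y - q y\<bar> < \<epsilon>)"
  proof (rule Stone_Weierstrass_HOL[of S P, OF _ _ _ _ _ _ g \<epsilon>])
    show "compact S" unfolding S_def by (rule compact_cube)
    show "P (\<lambda>y. c)" for c
      by (simp add: P_def trig_sums_const)
    show "P (\<lambda>y. p y + q y)" if "P p \<and> P q" for p q
      using that by (auto simp: P_def intro: continuous_on_add trig_sums.add)
    show "P (\<lambda>y. p y * q y)" if "P p \<and> P q" for p q
      using that by (auto simp: P_def intro: continuous_on_mult trig_sums_mult)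
    show "\<exists>q. P q \<and> q x \<noteq> q y" if xy: "x \<in> S \<and> y \<in> S \<and> x \<noteq> y" for x y
    proof -
      have "\<exists>i\<in>h ` J. x i \<noteq> y i"
      proof (rule ccontr)
        assume "\<not> (\<exists>i\<in>h ` J. x i \<noteq> y i)"
        then have "x = y" using xy unfolding S_def by (intro PiE_ext[of x "h ` J" _ y]) auto
        with xy show False by blast
      qed
      then obtain t where "t \<in> J" "x (h t) \<noteq> y (h t)" by blast
      then show ?thesis using coord by blast
    qed
  qed (simp add: P_def)
  then obtain q where q: "(\<lambda>x. q (\<phi> x)) \<in> trig_sums J" "\<And>y. y \<in> S \<Longrightarrow> \<bar>g y - q y\<bar> < \<epsilon>"
    unfolding P_def by blast
  have "\<bar>f x - q (\<phi> x)\<bar> \<le> \<epsilon> * (1 + (\<Sum>t\<in>J. (x t)\<^sup>2))" if x: "x \<in> extensional J" for x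
  proof -
    have "\<phi> x \<in> S" by (auto simp: \<phi>_def S_def)
    then have gq: "\<bar>g (\<phi> x) - q (\<phi> x)\<bar> < \<epsilon>" by (rule q(2))
    show ?thesis
    proof (cases "\<forall>t\<in>J. \<bar>x t\<bar> \<le> R")
      case True
      have "arcsin (\<phi> x (h t)) / b = x t" if "t \<in> J" for t
      proof -
        have "\<bar>b * x t\<bar> \<le> b * R" using True that \<open>b > 0\<close> by (simp add: abs_mult)
        also have "b * R = pi / 2" using R by (simp add: b_def)
        finally have "arcsin (sin (b * x t)) = b * x t" by (intro arcsin_sin) linarith+
        then show ?thesis using that \<open>b > 0\<close> by (simp add: \<phi>_def h)
      qed
      then have "(\<lambda>t\<in>J. arcsin (\<phi> x (h t)) / b) = x"
        using x by (auto simp: extensional_def restrict_def)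
      then have "g (\<phi> x) = f x" by (simp add: g_def)
      moreover have "\<epsilon> * 1 \<le> \<epsilon> * (1 + (\<Sum>t\<in>J. (x t)\<^sup>2))"
        using \<epsilon> by (intro mult_left_mono) (auto intro: sum_nonneg)
      ultimately show ?thesis using gq by simp
    next
      case False
      then obtain t where t: "t \<in> J" "R < \<bar>x t\<bar>" by force
      have "R\<^sup>2 \<le> \<bar>x t\<bar>\<^sup>2" using R t by (intro power_mono) auto
      also have "\<bar>x t\<bar>\<^sup>2 \<le> (\<Sum>t\<in>J. (x t)\<^sup>2)" using J t member_le_sum[of t J "\<lambda>t. (x t)\<^sup>2"] by simp
      finally have "\<epsilon> * R\<^sup>2 \<le> \<epsilon> * (\<Sum>t\<in>J. (x t)\<^sup>2)" using \<epsilon> by simp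
      moreover have "\<bar>f x\<bar> \<le> K" "\<bar>g (\<phi> x)\<bar> \<le> K" using K x by (auto simp: g_def)
      ultimately show ?thesis using R(2) gq by (simp add: distrib_left)
    qed
  qed
  with q(1) show ?thesis by (intro bexI[of _ "\<lambda>x. q (\<phi> x)"]) auto
qed

text \<open>The weighted approximation with \<open>\<epsilon> = 1/(n+1)\<close> exhibits \<open>f\<close> as a pointwise limit of
measurable functions.\<close>
lemma continuous_map_borel_measurable_PiM:
  assumes J: "finite J"
    and f: "continuous_map (product_topology (\<lambda>_. euclideanreal) J) euclideanreal f"
    and K: "\<And>x. x \<in> extensional J \<Longrightarrow> \<bar>f x\<bar> \<le> K"
  shows "f \<in> borel_measurable (PiM J (\<lambda>_. borel))"
proof -
  have "\<exists>p\<in>trig_sums J. \<forall>x\<in>extensional J. \<bar>f x - p x\<bar> \<le> inverse (real (Suc n)) * (1 + (\<Sum>t\<in>J. (x t)\<^sup>2))" for n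
    by (rule weighted_trigonometric_approximation[OF J f K]) auto
  then obtain p where p: "\<And>n. p n \<in> trig_sums J"
    "\<And>n x. x \<in> extensional J \<Longrightarrow> \<bar>f x - p n x\<bar> \<le> inverse (real (Suc n)) * (1 + (\<Sum>t\<in>J. (x t)\<^sup>2))"
    by metis
  show ?thesis
  proof (rule borel_measurable_LIMSEQ_real[of _ p])
    fix x :: "'a \<Rightarrow> real" assume "x \<in> space (PiM J (\<lambda>_. borel))"
    then have x: "x \<in> extensional J" by (simp add: space_PiM PiE_def)
    have "(\<lambda>n. inverse (real (Suc n)) * (1 + (\<Sum>t\<in>J. (x t)\<^sup>2))) \<longlonglongrightarrow> 0"
      using tendsto_mult_left_zero[OF LIMSEQ_inverse_real_of_nat] by simp
    then have "(\<lambda>n. p n x - f x) \<longlonglongrightarrow> 0"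
      by (rule Lim_null_comparison[rotated]) (use p(2)[OF x] in \<open>auto simp: abs_minus_commute\<close>)
    then show "(\<lambda>n. p n x) \<longlonglongrightarrow> f x" by (rule LIM_zero_cancel)
  qed (use p trig_sums_measurable in blast)
qed

text \<open>A continuity theorem for \<open>\<real>\<^sup>J\<close> whose limit law is already known. The second moment bound takes the place
of tightness: it makes the error of the weighted approximation uniformly small in mean, so that
only the integrals of one fixed trigonometric sum remain to be compared.\<close>
theorem weak_conv_on_cosine:
  assumes J: "finite J"
    and prob: "\<forall>\<^sub>F i in F. prob_space (\<mu> i)" "prob_space \<nu>"
    and sets: "\<forall>\<^sub>F i in F. sets (\<mu> i) = sets (PiM J (\<lambda>_. borel))" "sets \<nu> = sets (PiM J (\<lambda>_. borel))"
    and int: "\<forall>\<^sub>F i in F. \<forall>t\<in>J. integrable (\<mu> i) (\<lambda>x. (x t)\<^sup>2)" "\<forall>t\<in>J. integrable \<nu> (\<lambda>x. (x t)\<^sup>2)"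
    and bdd: "\<forall>\<^sub>F i in F. \<forall>t\<in>J. (\<integral>x. (x t)\<^sup>2 \<partial>\<mu> i) \<le> C"
    and cosine: "\<And>c \<theta>. ((\<lambda>i. \<integral>x. cos (\<theta> + (\<Sum>t\<in>J. c t * x t)) \<partial>\<mu> i) \<longlongrightarrow>
                   (\<integral>x. cos (\<theta> + (\<Sum>t\<in>J. c t * x t)) \<partial>\<nu>)) F"
  shows "weak_conv_on (product_topology (\<lambda>_. euclideanreal) J) \<mu> \<nu> F"
  unfolding weak_conv_on_def
proof (intro allI impI, elim conjE)
  fix f :: "('a \<Rightarrow> real) \<Rightarrow> real"
  assume f: "continuous_map (product_topology (\<lambda>_. euclideanreal) J) euclideanreal f"
    and "bounded (f ` topspace (product_topology (\<lambda>_. euclideanreal) J))"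
  then obtain K where K: "\<And>x. x \<in> extensional J \<Longrightarrow> \<bar>f x\<bar> \<le> K"
    by (auto simp: bounded_iff PiE_def)
  note f_meas = continuous_map_borel_measurable_PiM[OF J f K]
  have trig_int: "integrable m p" if "p \<in> trig_sums J" "prob_space m" "sets m = sets (PiM J (\<lambda>_. borel))" for m p
  proof -
    interpret prob_space m by fact
    obtain L where "\<forall>x. \<bar>p x\<bar> \<le> L" using trig_sums_bounded \<open>p \<in> _\<close> by blast
    then show ?thesis
      using trig_sums_measurable[OF \<open>p \<in> _\<close>] that(3)
      by (intro integrable_const_bound[of _ L]) (auto cong: measurable_cong_sets)
  qed
  have trig_conv: "((\<lambda>i. \<integral>x. p x \<partial>\<mu> i) \<longlongrightarrow> (\<integral>x. p x \<partial>\<nu>)) F" if "p \<in> trig_sums J" for p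
    using that
  proof induction
    case (wave a \<theta> c)
    show ?case using cosine by (simp add: tendsto_mult_left)
  next
    case (add p q)
    have "\<forall>\<^sub>F i in F. (\<integral>x. p x \<partial>\<mu> i) + (\<integral>x. q x \<partial>\<mu> i) = (\<integral>x. p x + q x \<partial>\<mu> i)"
      using prob(1) sets(1) by eventually_elim (simp add: trig_int add.hyps)
    moreover have "(\<integral>x. p x + q x \<partial>\<nu>) = (\<integral>x. p x \<partial>\<nu>) + (\<integral>x. q x \<partial>\<nu>)"
      using prob(2) sets(2) by (simp add: trig_int add.hyps)
    ultimately show ?case using tendsto_add[OF add.IH] by (auto intro: Lim_transform_eventually)
  qed
  have approx: "\<bar>(\<integral>x. f x \<partial>m) - (\<integral>x. p x \<partial>m)\<bar> \<le> \<epsilon> * (1 + (\<Sum>t\<in>J. \<integral>x. (x t)\<^sup>2 \<partial>m))"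
    if p: "p \<in> trig_sums J" "\<forall>x\<in>extensional J. \<bar>f x - p x\<bar> \<le> \<epsilon> * (1 + (\<Sum>t\<in>J. (x t)\<^sup>2))"
      and m: "prob_space m" "sets m = sets (PiM J (\<lambda>_. borel))" "\<forall>t\<in>J. integrable m (\<lambda>x. (x t)\<^sup>2)"
    for p m \<epsilon>
  proof -
    interpret prob_space m by fact
    have sp: "space m = extensional J" using sets_eq_imp_space_eq[OF m(2)] by (simp add: space_PiM PiE_def)
    have intf: "integrable m f"
      using f_meas m(2) K sp
      by (intro integrable_const_bound[of _ K]) (auto cong: measurable_cong_sets)
    have "\<bar>(\<integral>x. f x \<partial>m) - (\<integral>x. p x \<partial>m)\<bar> = \<bar>\<integral>x. f x - p x \<partial>m\<bar>"
      using intf trig_int[OF p(1) m(1,2)] by simp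
    also have "\<dots> \<le> (\<integral>x. \<bar>f x - p x\<bar> \<partial>m)" by (rule integral_abs_bound)
    also have "\<dots> \<le> (\<integral>x. \<epsilon> * (1 + (\<Sum>t\<in>J. (x t)\<^sup>2)) \<partial>m)"
      using intf trig_int[OF p(1) m(1,2)] m(3) p(2) sp by (intro integral_mono) auto
    also have "\<dots> = \<epsilon> * (1 + (\<Sum>t\<in>J. \<integral>x. (x t)\<^sup>2 \<partial>m))"
      using m(3) by (simp add: prob_space)
    finally show ?thesis .
  qed
  define D where "D = 1 + real (card J) * \<bar>C\<bar> + (\<Sum>t\<in>J. \<integral>x. (x t)\<^sup>2 \<partial>\<nu>)"
  have "D > 0" unfolding D_def by (intro add_pos_nonneg sum_nonneg) auto
  show "((\<lambda>i. \<integral>x. f x \<partial>\<mu> i) \<longlongrightarrow> (\<integral>x. f x \<partial>\<nu>)) F"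
  proof (rule tendstoI)
    fix e :: real assume "e > 0"
    define \<epsilon> where "\<epsilon> = e / (3 * D)"
    have "\<epsilon> > 0" "\<epsilon> * D = e / 3" using \<open>e > 0\<close> \<open>D > 0\<close> by (auto simp: \<epsilon>_def)
    obtain p where p: "p \<in> trig_sums J" "\<forall>x\<in>extensional J. \<bar>f x - p x\<bar> \<le> \<epsilon> * (1 + (\<Sum>t\<in>J. (x t)\<^sup>2))"
      using weighted_trigonometric_approximation[OF J f K \<open>\<epsilon> > 0\<close>] by blast
    have \<nu>: "\<bar>(\<integral>x. f x \<partial>\<nu>) - (\<integral>x. p x \<partial>\<nu>)\<bar> \<le> e / 3"
    proof -
      have "\<epsilon> * (1 + (\<Sum>t\<in>J. \<integral>x. (x t)\<^sup>2 \<partial>\<nu>)) \<le> \<epsilon> * D"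
        unfolding D_def using \<open>\<epsilon> > 0\<close> by (intro mult_left_mono) auto
      then show ?thesis using approx[OF p prob(2) sets(2) int(2)] \<open>\<epsilon> * D = e / 3\<close> by linarith
    qed
    have "\<forall>\<^sub>F i in F. dist (\<integral>x. p x \<partial>\<mu> i) (\<integral>x. p x \<partial>\<nu>) < e / 3"
      using tendstoD[OF trig_conv[OF p(1)], of "e / 3"] \<open>e > 0\<close> by simp
    then show "\<forall>\<^sub>F i in F. dist (\<integral>x. f x \<partial>\<mu> i) (\<integral>x. f x \<partial>\<nu>) < e"
      using prob(1) sets(1) int(1) bdd
    proof eventually_elim
      case (elim i)
      have "(\<Sum>t\<in>J. \<integral>x. (x t)\<^sup>2 \<partial>\<mu> i) \<le> (\<Sum>t\<in>J. \<bar>C\<bar>)"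
        using elim(5) by (intro sum_mono) force
      moreover have "0 \<le> (\<Sum>t\<in>J. \<integral>x. (x t)\<^sup>2 \<partial>\<nu>)" by (intro sum_nonneg) auto
      ultimately have "\<epsilon> * (1 + (\<Sum>t\<in>J. \<integral>x. (x t)\<^sup>2 \<partial>\<mu> i)) \<le> \<epsilon> * D"
        unfolding D_def using \<open>\<epsilon> > 0\<close> by (intro mult_left_mono) auto
      then have "\<bar>(\<integral>x. f x \<partial>\<mu> i) - (\<integral>x. p x \<partial>\<mu> i)\<bar> \<le> e / 3"
        using approx[OF p elim(2,3,4)] \<open>\<epsilon> * D = e / 3\<close> by linarith
      then show ?case using elim(1) \<nu> unfolding dist_real_def by linarith
    qed
  qed
qed

section \<open>Centred Gaussian processes\<close>

text \<open>Writing every normal law, the Dirac masses included, as an affine image of the standard one removes the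
case distinction in its definition from all moment computations.\<close>
lemma normal_law_eq_distr:
  assumes "\<sigma> \<ge> 0"
  shows "normal_law \<mu> \<sigma> = distr std_normal_distribution borel (\<lambda>z. \<mu> + \<sigma> * z)"
proof (cases "\<sigma> = 0")
  case True
  interpret prob_space std_normal_distribution by (rule prob_space_normal_density) simp
  show ?thesis using True by (simp add: normal_law_def distr_const)
next
  case False
  with assms have "\<sigma> > 0" by simp
  interpret prob_space std_normal_distribution by (rule prob_space_normal_density) simp
  have "distributed std_normal_distribution lborel (\<lambda>x. x) std_normal_density"
    by (auto simp: distributed_def intro!: distr_id2[THEN trans])
  from normal_density_affine[OF this, of \<sigma> \<mu>] \<open>\<sigma> > 0\<close>
  have "distributed std_normal_distribution lborel (\<lambda>x. \<mu> + \<sigma> * x) (normal_density \<mu> \<sigma>)" by simp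
  then have "distr std_normal_distribution lborel (\<lambda>x. \<mu> + \<sigma> * x) = density lborel (normal_density \<mu> \<sigma>)"
    by (rule distributed_distr_eq_density)
  moreover have "distr std_normal_distribution lborel (\<lambda>x. \<mu> + \<sigma> * x) =
      distr std_normal_distribution borel (\<lambda>x. \<mu> + \<sigma> * x)"
    by (rule distr_cong) auto
  ultimately show ?thesis using \<open>\<sigma> > 0\<close> by (simp add: normal_law_def)
qed

lemma
  assumes "\<sigma> \<ge> 0"
  shows integrable_normal_law: "integrable (normal_law \<mu> \<sigma>) (\<lambda>x. x)"
    and integrable_normal_law_power2: "integrable (normal_law \<mu> \<sigma>) (\<lambda>x. x\<^sup>2)"
    and integral_normal_law: "(\<integral>x. x \<partial>normal_law \<mu> \<sigma>) = \<mu>"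
    and integral_normal_law_power2: "(\<integral>x. x\<^sup>2 \<partial>normal_law \<mu> \<sigma>) = \<mu>\<^sup>2 + \<sigma>\<^sup>2"
    and integral_normal_law_cos: "(\<integral>x. cos (\<theta> + x) \<partial>normal_law \<mu> \<sigma>) = cos (\<theta> + \<mu>) * exp (- \<sigma>\<^sup>2 / 2)"
proof -
  define N where "N = std_normal_distribution"
  interpret prob_space N unfolding N_def by (rule prob_space_normal_density) simp
  have [measurable_cong, simp]: "sets N = sets borel" by (simp add: N_def)
  have i1: "integrable N (\<lambda>z. z)" and i2: "integrable N (\<lambda>z. z\<^sup>2)"
    using integrable_std_normal_distribution_moment[of 1] integrable_std_normal_distribution_moment[of 2] unfolding N_def by simp_all
  have e1: "(\<integral>z. z \<partial>N) = 0" and e2: "(\<integral>z. z\<^sup>2 \<partial>N) = 1"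
    using integral_std_normal_distribution_moment_odd[of 1] std_normal_distribution_even_moments(1)[of 1]
    unfolding N_def by (simp_all add: fact_numeral)
  have sq: "(\<lambda>z. (\<mu> + \<sigma> * z)\<^sup>2) = (\<lambda>z. \<mu>\<^sup>2 + 2 * \<mu> * \<sigma> * z + \<sigma>\<^sup>2 * z\<^sup>2)"
    by (simp add: power2_eq_square algebra_simps)
  have j1: "integrable N (\<lambda>z. \<mu> + \<sigma> * z)"
    by (intro Bochner_Integration.integrable_add integrable_mult_right i1) simp
  have j2: "integrable N (\<lambda>z. (\<mu> + \<sigma> * z)\<^sup>2)"
    unfolding sq by (intro Bochner_Integration.integrable_add integrable_mult_right i1 i2) simp
  have [measurable]: "(\<lambda>z. \<mu> + \<sigma> * z) \<in> borel_measurable N"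
    using j1 by (rule borel_measurable_integrable)
  note law = normal_law_eq_distr[OF assms, folded N_def]
  show "integrable (normal_law \<mu> \<sigma>) (\<lambda>x. x)"
    unfolding law by (subst integrable_distr_eq) (use j1 in auto)
  show "integrable (normal_law \<mu> \<sigma>) (\<lambda>x. x\<^sup>2)"
    unfolding law by (subst integrable_distr_eq) (use j2 in auto)
  have "(\<integral>x. x \<partial>normal_law \<mu> \<sigma>) = (\<integral>z. \<mu> + \<sigma> * z \<partial>N)"
    unfolding law by (rule integral_distr) auto
  also have "\<dots> = (\<integral>z. \<mu> \<partial>N) + \<sigma> * (\<integral>z. z \<partial>N)"
    by (subst Bochner_Integration.integral_add) (auto intro!: integrable_mult_right i1)
  finally show "(\<integral>x. x \<partial>normal_law \<mu> \<sigma>) = \<mu>"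
    by (simp add: e1 prob_space)
  have "(\<integral>x. x\<^sup>2 \<partial>normal_law \<mu> \<sigma>) = (\<integral>z. (\<mu> + \<sigma> * z)\<^sup>2 \<partial>N)"
    unfolding law by (rule integral_distr) auto
  also have "\<dots> = (\<integral>z. \<mu>\<^sup>2 + 2 * \<mu> * \<sigma> * z \<partial>N) + \<sigma>\<^sup>2 * (\<integral>z. z\<^sup>2 \<partial>N)"
    unfolding sq
    by (subst Bochner_Integration.integral_add)
       (auto intro!: Bochner_Integration.integrable_add integrable_mult_right i1 i2)
  also have "(\<integral>z. \<mu>\<^sup>2 + 2 * \<mu> * \<sigma> * z \<partial>N) = (\<integral>z. \<mu>\<^sup>2 \<partial>N) + 2 * \<mu> * \<sigma> * (\<integral>z. z \<partial>N)"
    by (subst Bochner_Integration.integral_add) (auto intro!: integrable_mult_right i1)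
  finally show "(\<integral>x. x\<^sup>2 \<partial>normal_law \<mu> \<sigma>) = \<mu>\<^sup>2 + \<sigma>\<^sup>2"
    by (simp add: e1 e2 prob_space)
  have iexp_int: "integrable N (\<lambda>z. iexp (a + \<sigma> * z))" for a
    by (rule integrable_iexp) auto
  have "complex_of_real (exp (- \<sigma>\<^sup>2 / 2)) = (CLINT z|N. iexp (\<sigma> * z))"
    using fun_cong[OF char_std_normal_distribution, of \<sigma>] by (simp add: char_def N_def)
  then have "iexp (\<theta> + \<mu>) * complex_of_real (exp (- \<sigma>\<^sup>2 / 2)) = (CLINT z|N. iexp (\<theta> + \<mu>) * iexp (\<sigma> * z))"
    by simp
  also have "\<dots> = (CLINT z|N. iexp ((\<theta> + \<mu>) + \<sigma> * z))"
    by (simp add: exp_add[symmetric] distrib_left)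
  finally have "Re (CLINT z|N. iexp ((\<theta> + \<mu>) + \<sigma> * z)) = Re (iexp (\<theta> + \<mu>) * complex_of_real (exp (- \<sigma>\<^sup>2 / 2)))"
    by (rule arg_cong[OF sym])
  also have "\<dots> = cos (\<theta> + \<mu>) * exp (- \<sigma>\<^sup>2 / 2)"
    by (simp add: Re_exp)
  also have "Re (CLINT z|N. iexp ((\<theta> + \<mu>) + \<sigma> * z)) = (\<integral>z. cos ((\<theta> + \<mu>) + \<sigma> * z) \<partial>N)"
    by (subst integral_Re[symmetric, OF iexp_int]) (simp add: Re_exp)
  finally show "(\<integral>x. cos (\<theta> + x) \<partial>normal_law \<mu> \<sigma>) = cos (\<theta> + \<mu>) * exp (- \<sigma>\<^sup>2 / 2)"
    unfolding law by (simp add: integral_distr add.assoc)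
qed

lemma gaussian_process_measurable:
  "gaussian_process M T X \<Longrightarrow> t \<in> T \<Longrightarrow> X t \<in> borel_measurable M"
  unfolding gaussian_process_def by blast

lemma gaussian_process_normal_law:
  assumes "gaussian_process M T X" "finite J" "J \<subseteq> T"
  obtains \<mu> \<sigma> where "\<sigma> \<ge> 0" "distr M borel (\<lambda>\<omega>. \<Sum>t\<in>J. c t * X t \<omega>) = normal_law \<mu> \<sigma>"
    "(\<lambda>\<omega>. \<Sum>t\<in>J. c t * X t \<omega>) \<in> borel_measurable M"
proof -
  have "(\<lambda>\<omega>. \<Sum>t\<in>J. c t * X t \<omega>) \<in> borel_measurable M"
    using assms by (intro borel_measurable_sum borel_measurable_times) (auto intro: gaussian_process_measurable)
  then show thesis
    using assms that unfolding gaussian_process_def by blast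
qed

lemma
  assumes "gaussian_process M T X" "finite J" "J \<subseteq> T"
  shows gaussian_process_integrable_sum: "integrable M (\<lambda>\<omega>. \<Sum>t\<in>J. c t * X t \<omega>)"
    and gaussian_process_integrable_sum_power2: "integrable M (\<lambda>\<omega>. (\<Sum>t\<in>J. c t * X t \<omega>)\<^sup>2)"
proof -
  from gaussian_process_normal_law[OF assms, of c] obtain \<mu> \<sigma> where
    "\<sigma> \<ge> 0" and d: "distr M borel (\<lambda>\<omega>. \<Sum>t\<in>J. c t * X t \<omega>) = normal_law \<mu> \<sigma>"
    and m: "(\<lambda>\<omega>. \<Sum>t\<in>J. c t * X t \<omega>) \<in> borel_measurable M" .
  show "integrable M (\<lambda>\<omega>. \<Sum>t\<in>J. c t * X t \<omega>)"
    using integrable_normal_law[OF \<open>\<sigma> \<ge> 0\<close>, of \<mu>] m by (simp add: d[symmetric] integrable_distr_eq)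
  show "integrable M (\<lambda>\<omega>. (\<Sum>t\<in>J. c t * X t \<omega>)\<^sup>2)"
    using integrable_normal_law_power2[OF \<open>\<sigma> \<ge> 0\<close>, of \<mu>] m by (simp add: d[symmetric] integrable_distr_eq)
qed

lemma
  assumes "gaussian_process M T X" "t \<in> T"
  shows gaussian_process_integrable: "integrable M (X t)"
    and gaussian_process_integrable_power2: "integrable M (\<lambda>\<omega>. (X t \<omega>)\<^sup>2)"
  using gaussian_process_integrable_sum[OF assms(1), of "{t}" "\<lambda>_. 1"]
    gaussian_process_integrable_sum_power2[OF assms(1), of "{t}" "\<lambda>_. 1"] assms(2) by simp_all

lemma gaussian_process_integrable_mult:
  assumes "gaussian_process M T X" "t \<in> T" "s \<in> T"
  shows "integrable M (\<lambda>\<omega>. X t \<omega> * X s \<omega>)"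
proof (rule Bochner_Integration.integrable_bound)
  show "integrable M (\<lambda>\<omega>. (X t \<omega>)\<^sup>2 + (X s \<omega>)\<^sup>2)"
    using assms by (auto intro: gaussian_process_integrable_power2)
  show "(\<lambda>\<omega>. X t \<omega> * X s \<omega>) \<in> borel_measurable M"
    using assms by (intro borel_measurable_times gaussian_process_measurable)
  have "\<bar>a * b\<bar> \<le> \<bar>a\<^sup>2 + b\<^sup>2\<bar>" for a b :: real
  proof -
    have "0 \<le> \<bar>a\<bar> * \<bar>b\<bar>" by simp
    then show ?thesis
      using sum_squares_bound[of "\<bar>a\<bar>" "\<bar>b\<bar>"] unfolding abs_mult power2_abs by linarith
  qed
  then show "AE \<omega> in M. norm (X t \<omega> * X s \<omega>) \<le> norm ((X t \<omega>)\<^sup>2 + (X s \<omega>)\<^sup>2)"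
    by simp
qed

lemma centered_gaussian_power2:
  assumes X: "gaussian_process M T X" and mean: "\<And>t. t \<in> T \<Longrightarrow> mean_fun M X t = 0"
    and J: "finite J" "J \<subseteq> T"
  shows "(\<integral>\<omega>. (\<Sum>t\<in>J. c t * X t \<omega>)\<^sup>2 \<partial>M) = (\<Sum>t\<in>J. \<Sum>s\<in>J. c t * c s * cov_fun M X t s)"
proof -
  have "(\<lambda>\<omega>. (\<Sum>t\<in>J. c t * X t \<omega>)\<^sup>2) = (\<lambda>\<omega>. \<Sum>t\<in>J. \<Sum>s\<in>J. c t * c s * (X t \<omega> * X s \<omega>))"
    by (simp add: power2_eq_square sum_product ac_simps)
  moreover have "integrable M (\<lambda>\<omega>. X t \<omega> * X s \<omega>)" if "t \<in> J" "s \<in> J" for t s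
    using that J by (intro gaussian_process_integrable_mult[OF X]) auto
  moreover have "cov_fun M X t s = (\<integral>\<omega>. X t \<omega> * X s \<omega> \<partial>M)" if "t \<in> J" "s \<in> J" for t s
    using that J mean by (auto simp: cov_fun_def subset_iff)
  ultimately show ?thesis
    by simp
qed

text \<open>The mean of a linear combination is a combination of means, hence zero, and its variance is read off
the covariances. So the cosine transform of a centred Gaussian process depends on its covariance
function alone.\<close>
lemma centered_gaussian_cos:
  assumes X: "gaussian_process M T X" and mean: "\<And>t. t \<in> T \<Longrightarrow> mean_fun M X t = 0"
    and J: "finite J" "J \<subseteq> T"
  shows "(\<integral>\<omega>. cos (\<theta> + (\<Sum>t\<in>J. c t * X t \<omega>)) \<partial>M) =
    cos \<theta> * exp (- (\<Sum>t\<in>J. \<Sum>s\<in>J. c t * c s * cov_fun M X t s) / 2)"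
proof -
  let ?Y = "\<lambda>\<omega>. \<Sum>t\<in>J. c t * X t \<omega>"
  from gaussian_process_normal_law[OF X J, of c] obtain \<mu> \<sigma> where
    "\<sigma> \<ge> 0" and d: "distr M borel ?Y = normal_law \<mu> \<sigma>" and [measurable]: "?Y \<in> borel_measurable M" .
  have law: "(\<integral>\<omega>. h (?Y \<omega>) \<partial>M) = (\<integral>y. h y \<partial>normal_law \<mu> \<sigma>)" if "h \<in> borel_measurable borel" for h :: "real \<Rightarrow> real"
    using that by (simp add: d[symmetric] integral_distr)
  have "(\<integral>\<omega>. ?Y \<omega> \<partial>M) = (\<Sum>t\<in>J. c t * mean_fun M X t)"
    unfolding mean_fun_def using J
    by (subst Bochner_Integration.integral_sum) (auto intro!: gaussian_process_integrable[OF X])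
  also have "\<dots> = 0" using J mean by (intro sum.neutral) auto
  finally have "\<mu> = 0"
    using law[of "\<lambda>x. x"] integral_normal_law[OF \<open>\<sigma> \<ge> 0\<close>, of \<mu>] by simp
  have "(\<Sum>t\<in>J. \<Sum>s\<in>J. c t * c s * cov_fun M X t s) = \<sigma>\<^sup>2"
    using law[of "\<lambda>x. x\<^sup>2"] integral_normal_law_power2[OF \<open>\<sigma> \<ge> 0\<close>, of \<mu>] \<open>\<mu> = 0\<close>
    by (simp add: centered_gaussian_power2[OF X mean J])
  then show ?thesis
    using law[of "\<lambda>x. cos (\<theta> + x)"] integral_normal_law_cos[OF \<open>\<sigma> \<ge> 0\<close>, where \<theta> = \<theta> and \<mu> = \<mu>] \<open>\<mu> = 0\<close> by simp
qed

section \<open>Riemann sums and the transform of a path\<close>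

lemma has_integral_mult_indicator_greaterThanAtMost:
  fixes a b c d e :: real
  assumes "d \<le> a" "a \<le> b" "b \<le> e"
  shows "((\<lambda>s. c * indicator {a<..b} s) has_integral c * (b - a)) {d..e}"
proof -
  have "((\<lambda>s. c) has_integral c * (b - a)) {a..b}"
    using has_integral_const_real[of c a b] assms by (simp add: mult.commute)
  then have "((\<lambda>s. if s \<in> {a..b} then c else 0) has_integral c * (b - a)) {d..e}"
    using assms by (subst has_integral_restrict) auto
  then show ?thesis
    by (rule has_integral_spike_finite[of "{a}", rotated 2]) (auto simp: indicator_def)
qed

text \<open>Riemann sums of a varying sequence of integrands. The hypothesis is continuous convergence:
\<open>h\<^sub>n (x\<^sub>n) \<rightarrow> g x\<close> whenever \<open>x\<^sub>n \<rightarrow> x\<close>. It passes through one integration, so the lemma can be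
applied again to the resulting function, which a statement for one fixed continuous integrand would
not allow. The Riemann sum is the integral of the step function \<open>f n\<close> that takes at \<open>s\<close> the value of
\<open>h n\<close> at the next node to the right; these step functions converge pointwise and boundedly.\<close>
lemma
  fixes h :: "nat \<Rightarrow> real \<Rightarrow> real" and g :: "real \<Rightarrow> real"
  assumes t: "t \<ge> 0"
    and bound: "\<And>n x. x \<in> {0..t} \<Longrightarrow> \<bar>h n x\<bar> \<le> C"
    and conv: "\<And>x xs. x \<in> {0..t} \<Longrightarrow> (\<And>n. xs n \<in> {0..t}) \<Longrightarrow> xs \<longlonglongrightarrow> x \<Longrightarrow> (\<lambda>n. h n (xs n)) \<longlonglongrightarrow> g x"
  shows integrable_on_continuously_convergent: "g integrable_on {0..t}"
    and Riemann_sums_tendsto_integral: "(\<lambda>n. t / Suc n * (\<Sum>k\<le>n. h n (t * Suc k / Suc n))) \<longlonglongrightarrow> integral {0..t} g"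
proof -
  define f where "f n s = (\<Sum>k\<le>n. h n (t * Suc k / Suc n) * indicator {t * k / Suc n <.. t * Suc k / Suc n} s)" for n s
  \<comment> \<open>No half-open cell contains 0, so the step functions vanish there.\<close>
  define g' where "g' s = (if s = 0 then 0 else g s)" for s
  have f_int: "(f n has_integral t / Suc n * (\<Sum>k\<le>n. h n (t * Suc k / Suc n))) {0..t}" for n
  proof -
    have "(f n has_integral (\<Sum>k\<le>n. h n (t * Suc k / Suc n) * (t * Suc k / Suc n - t * k / Suc n))) {0..t}"
      unfolding f_def
    proof (intro has_integral_sum has_integral_mult_indicator_greaterThanAtMost)
      fix k assume "k \<in> {..n}"
      then have "t * real (Suc k) \<le> t * real (Suc n)" using t by (intro mult_left_mono) auto
      then show "t * real (Suc k) / real (Suc n) \<le> t" by (simp add: divide_le_eq)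
      show "t * real k / real (Suc n) \<le> t * real (Suc k) / real (Suc n)"
        using t by (intro divide_right_mono mult_left_mono) auto
    qed (use t in auto)
    moreover have "t * Suc k / Suc n - t * k / Suc n = t / Suc n" for k
      by (simp only: diff_divide_distrib[symmetric] right_diff_distrib[symmetric]) simp
    ultimately show ?thesis by (simp add: sum_distrib_left mult.commute)
  qed
  have f_eq: "\<exists>x\<in>{0..t}. \<bar>x - s\<bar> \<le> t / Suc n \<and> f n s = h n x" if s: "s \<in> {0<..t}" for n s
  proof -
    define N where "N = real (Suc n)"
    have N: "N > 0" by (simp add: N_def)
    have "t > 0" using s by simp
    have pos: "0 < s * N / t" using s N \<open>t > 0\<close> by simp
    \<comment> \<open>The index of the cell that contains \<open>s\<close>.\<close>
    obtain k where k: "real k < s * N / t" "s * N / t \<le> real k + 1"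
    proof
      have "\<lceil>s * N / t\<rceil> \<ge> 1" using pos by linarith
      then have "real (nat (\<lceil>s * N / t\<rceil> - 1)) = of_int \<lceil>s * N / t\<rceil> - 1" by simp
      then show "real (nat (\<lceil>s * N / t\<rceil> - 1)) < s * N / t" "s * N / t \<le> real (nat (\<lceil>s * N / t\<rceil> - 1)) + 1"
        by linarith+
    qed
    have "s * N / t \<le> N" using s N \<open>t > 0\<close> by (simp add: divide_le_eq mult.commute)
    with k have "real k < real (Suc n)" unfolding N_def by linarith
    then have "k \<le> n" by simp
    have ind: "indicator {t * j / Suc n <.. t * Suc j / Suc n} s = (if j = k then 1 else 0 :: real)" for j
    proof -
      have "s \<in> {t * j / Suc n <.. t * Suc j / Suc n} \<longleftrightarrow> real j < s * N / t \<and> s * N / t \<le> real j + 1"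
        using N \<open>t > 0\<close> unfolding N_def[symmetric] by (simp add: field_simps)
      also have "\<dots> \<longleftrightarrow> j = k"
      proof
        assume "real j < s * N / t \<and> s * N / t \<le> real j + 1"
        with k have "real j < real (Suc k)" "real k < real (Suc j)" by auto
        then show "j = k" by simp
      qed (use k in auto)
      finally show ?thesis by (auto simp: indicator_def)
    qed
    have "f n s = h n (t * Suc k / Suc n)"
      unfolding f_def ind using \<open>k \<le> n\<close> by (simp add: if_distrib[of "\<lambda>u. _ * u"] cong: if_cong)
    moreover have "t * Suc k / Suc n \<le> t"
    proof -
      have "t * real (Suc k) \<le> t * real (Suc n)" using t \<open>k \<le> n\<close> by (intro mult_left_mono) auto
      then show ?thesis by (simp add: divide_le_eq)
    qed
    moreover have "\<bar>t * Suc k / Suc n - s\<bar> \<le> t / Suc n"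
    proof -
      have "t * k / N < s" "s \<le> t * (k + 1) / N" "t * (k + 1) / N = t * k / N + t / N"
        using k N \<open>t > 0\<close> by (simp_all add: field_simps)
      then show ?thesis unfolding N_def by (simp add: add.commute)
    qed
    moreover have "0 \<le> t * Suc k / Suc n" using t by simp
    ultimately show ?thesis by (intro bexI[of _ "t * Suc k / Suc n"]) auto
  qed
  have "C \<ge> 0" using bound[of 0 0] t by force
  have f0: "f n 0 = 0" for n
    unfolding f_def using t by (intro sum.neutral) (auto simp: indicator_def not_less)
  have f_bound: "norm (f n s) \<le> C" if "s \<in> {0..t}" for n s
  proof (cases "s = 0")
    case False
    then have "s \<in> {0<..t}" using that by simp
    then obtain x where "x \<in> {0..t}" "f n s = h n x" using f_eq by blast
    then show ?thesis using bound by simp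
  qed (use \<open>C \<ge> 0\<close> f0 in simp)
  have f_conv: "(\<lambda>n. f n s) \<longlonglongrightarrow> g' s" if "s \<in> {0..t}" for s
  proof (cases "s = 0")
    case False
    then have "s \<in> {0<..t}" using that by simp
    then have "\<forall>n. \<exists>x. x \<in> {0..t} \<and> \<bar>x - s\<bar> \<le> t / Suc n \<and> f n s = h n x"
      using f_eq by blast
    then obtain x where x: "\<And>n. x n \<in> {0..t}" "\<And>n. \<bar>x n - s\<bar> \<le> t / Suc n" "\<And>n. f n s = h n (x n)"
      by metis
    have "(\<lambda>n. t / Suc n) \<longlonglongrightarrow> 0"
      using tendsto_mult_right_zero[OF LIMSEQ_inverse_real_of_nat, of t] by (simp add: field_simps)
    then have "(\<lambda>n. x n - s) \<longlonglongrightarrow> 0"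
      by (rule Lim_null_comparison[rotated]) (use x(2) in auto)
    then have "x \<longlonglongrightarrow> s" by (rule LIM_zero_cancel)
    then show ?thesis using conv[OF that x(1)] x(3) False by (simp add: g'_def)
  qed (simp add: f0 g'_def)
  have dc: "g' integrable_on {0..t}" "(\<lambda>n. integral {0..t} (f n)) \<longlonglongrightarrow> integral {0..t} g'"
    using dominated_convergence[of f "{0..t}" "\<lambda>_. C" g'] f_int f_bound f_conv by blast+
  show "g integrable_on {0..t}"
    by (rule integrable_spike_finite[of "{0}", OF _ _ dc(1)]) (auto simp: g'_def)
  have "integral {0..t} g' = integral {0..t} g"
    by (rule integral_spike[of "{0}"]) (auto simp: g'_def)
  then show "(\<lambda>n. t / Suc n * (\<Sum>k\<le>n. h n (t * Suc k / Suc n))) \<longlonglongrightarrow> integral {0..t} g"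
    using dc(2) integral_unique[OF f_int] by simp
qed

text \<open>After integration by parts this is \<open>\<integral>\<^sub>0\<^sup>t e\<^sup>s dg(s) + g 0\<close>; the processes in question
are its values on the paths of fractional Brownian motion.\<close>
definition ibp :: "real \<Rightarrow> (real \<Rightarrow> real) \<Rightarrow> real" where
  "ibp t g = exp t * g t - integral {0..t} (\<lambda>s. exp s * g s)"

definition ibp_sum :: "nat \<Rightarrow> real \<Rightarrow> (real \<Rightarrow> real) \<Rightarrow> real" where
  "ibp_sum n t g = exp t * g t
     - t / Suc n * (\<Sum>k\<le>n. exp (t * Suc k / Suc n) * g (t * Suc k / Suc n))"

lemma
  assumes t: "t \<ge> 0"
    and bound: "\<And>n x. x \<in> {0..t} \<Longrightarrow> \<bar>g n x\<bar> \<le> C"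
    and conv: "\<And>x xs. x \<in> {0..t} \<Longrightarrow> (\<And>n. xs n \<in> {0..t}) \<Longrightarrow> xs \<longlonglongrightarrow> x \<Longrightarrow> (\<lambda>n. g n (xs n)) \<longlonglongrightarrow> l x"
  shows exp_mult_integrable_on_continuously_convergent: "(\<lambda>s. exp s * l s) integrable_on {0..t}"
    and ibp_sum_tendsto: "(\<lambda>n. ibp_sum n t (g n)) \<longlonglongrightarrow> ibp t l"
proof -
  have bound': "\<bar>exp x * g n x\<bar> \<le> exp t * C" if "x \<in> {0..t}" for n x
    using bound[OF that] that by (simp add: abs_mult mult_mono)
  have conv': "(\<lambda>n. exp (xs n) * g n (xs n)) \<longlonglongrightarrow> exp x * l x"
    if "x \<in> {0..t}" "\<And>n. xs n \<in> {0..t}" "xs \<longlonglongrightarrow> x" for x xs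
    using that by (intro tendsto_intros conv)
  show "(\<lambda>s. exp s * l s) integrable_on {0..t}"
    by (rule integrable_on_continuously_convergent[OF t bound' conv'])
  have "(\<lambda>n. g n t) \<longlonglongrightarrow> l t"
    using conv[of t "\<lambda>_. t"] t by simp
  then show "(\<lambda>n. ibp_sum n t (g n)) \<longlonglongrightarrow> ibp t l"
    unfolding ibp_sum_def ibp_def
    by (intro tendsto_diff tendsto_mult tendsto_const Riemann_sums_tendsto_integral[OF t bound' conv'])
qed

lemma continuous_on_bounded_Icc:
  fixes g :: "real \<Rightarrow> real"
  assumes "continuous_on {0..} g"
  obtains C where "\<And>x. x \<in> {0..t} \<Longrightarrow> \<bar>g x\<bar> \<le> C"
proof -
  have "bounded (g ` {0..t})"
    by (intro compact_imp_bounded compact_continuous_image continuous_on_subset[OF assms]) auto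
  then obtain C where "\<forall>y\<in>g ` {0..t}. norm y \<le> C"
    unfolding bounded_iff by blast
  then have "\<bar>g x\<bar> \<le> C" if "x \<in> {0..t}" for x
    using that by simp
  then show thesis by (rule that)
qed

lemma ibp_sum_tendsto_continuous:
  assumes t: "t \<ge> 0" and g: "continuous_on {0..} g"
  shows "(\<lambda>n. ibp_sum n t g) \<longlonglongrightarrow> ibp t g"
proof -
  obtain C where C: "\<And>x. x \<in> {0..t} \<Longrightarrow> \<bar>g x\<bar> \<le> C"
    using continuous_on_bounded_Icc[OF g] by blast
  show ?thesis
  proof (rule ibp_sum_tendsto[OF t C])
    show "(\<lambda>n. g (xs n)) \<longlonglongrightarrow> g x" if "x \<in> {0..t}" "\<And>n. xs n \<in> {0..t}" "xs \<longlonglongrightarrow> x" for x xs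
      using that by (intro continuous_on_tendsto_compose[OF g]) auto
  qed
qed

lemma ibp_sum_bound:
  assumes "t \<ge> 0" "\<And>x. x \<in> {0..t} \<Longrightarrow> \<bar>g x\<bar> \<le> C"
  shows "\<bar>ibp_sum n t g\<bar> \<le> exp t * C * (1 + t)"
proof -
  have node: "t * Suc k / Suc n \<in> {0..t}" if "k \<le> n" for k
  proof -
    have "t * real (Suc k) \<le> t * real (Suc n)" using assms(1) that by (intro mult_left_mono) auto
    then show ?thesis using assms(1) by (simp add: divide_le_eq)
  qed
  have g: "\<bar>exp x * g x\<bar> \<le> exp t * C" if "x \<in> {0..t}" for x
    using assms(2)[OF that] that by (simp add: abs_mult mult_mono)
  have "\<bar>\<Sum>k\<le>n. exp (t * Suc k / Suc n) * g (t * Suc k / Suc n)\<bar> \<le> (\<Sum>k\<le>n. exp t * C)"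
    using node g by (intro order_trans[OF sum_abs] sum_mono) auto
  then have "\<bar>t / Suc n * (\<Sum>k\<le>n. exp (t * Suc k / Suc n) * g (t * Suc k / Suc n))\<bar> \<le> t / Suc n * (Suc n * (exp t * C))"
    unfolding abs_mult using assms(1) by (intro mult_mono) auto
  also have "\<dots> = exp t * C * t" by (simp del: of_nat_Suc)
  finally show ?thesis
    unfolding ibp_sum_def using g[of t] assms(1)
    by (simp only: distrib_left mult_1_right) (use abs_triangle_ineq4 in \<open>force intro: order_trans[OF abs_triangle_ineq4]\<close>)
qed

text \<open>Applied to both arguments of a covariance function, the functional gives the covariance of the
transformed process. The inner Riemann sums converge continuously in the outer variable, as \<open>K\<close> is
jointly continuous, so the convergence lemma can be applied twice.\<close>
lemma
  assumes t: "t \<ge> 0" and s: "s \<ge> 0"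
    and K: "continuous_on ({0..} \<times> {0..}) (\<lambda>(u, w). K u w)"
  shows ibp_kernel_integrable: "(\<lambda>u. exp u * ibp s (K u)) integrable_on {0..t}"
    and ibp_sum_kernel_tendsto: "(\<lambda>n. ibp_sum n t (\<lambda>u. ibp_sum n s (K u))) \<longlonglongrightarrow> ibp t (\<lambda>u. ibp s (K u))"
proof -
  have "bounded ((\<lambda>(u, w). K u w) ` ({0..t} \<times> {0..s}))"
    by (intro compact_imp_bounded compact_continuous_image continuous_on_subset[OF K] compact_Times) auto
  then obtain C where "\<forall>y\<in>(\<lambda>(u, w). K u w) ` ({0..t} \<times> {0..s}). norm y \<le> C"
    unfolding bounded_iff by blast
  then have C: "\<bar>K u w\<bar> \<le> C" if "u \<in> {0..t}" "w \<in> {0..s}" for u w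
    using that by force
  have b: "\<bar>ibp_sum n s (K u)\<bar> \<le> exp s * C * (1 + s)" if "u \<in> {0..t}" for n u
    using that C by (intro ibp_sum_bound s) auto
  have c: "(\<lambda>n. ibp_sum n s (K (us n))) \<longlonglongrightarrow> ibp s (K u)"
    if u: "u \<in> {0..t}" "\<And>n. us n \<in> {0..t}" "us \<longlonglongrightarrow> u" for u us
  proof (rule ibp_sum_tendsto[OF s])
    show "\<bar>K (us n) w\<bar> \<le> C" if "w \<in> {0..s}" for n w using C u that by auto
    show "(\<lambda>n. K (us n) (ws n)) \<longlonglongrightarrow> K u w"
      if w: "w \<in> {0..s}" "\<And>n. ws n \<in> {0..s}" "ws \<longlonglongrightarrow> w" for w ws
    proof -
      have "(\<lambda>n. (us n, ws n)) \<longlonglongrightarrow> (u, w)" by (intro tendsto_Pair u w)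
      from continuous_on_tendsto_compose[OF K this] show ?thesis
        using u w by auto
    qed
  qed
  show "(\<lambda>u. exp u * ibp s (K u)) integrable_on {0..t}"
    by (rule exp_mult_integrable_on_continuously_convergent[OF t b c])
  show "(\<lambda>n. ibp_sum n t (\<lambda>u. ibp_sum n s (K u))) \<longlonglongrightarrow> ibp t (\<lambda>u. ibp s (K u))"
    by (rule ibp_sum_tendsto[OF t b c])
qed

section \<open>Finite functionals\<close>

text \<open>Functionals of finitely many values: exactly those to which the definition of a Gaussian process
applies. Merging repeated evaluation points happens once, in the closure properties below.\<close>
definition finite_functional :: "'t set \<Rightarrow> (('t \<Rightarrow> real) \<Rightarrow> real) \<Rightarrow> bool" where
  "finite_functional S \<Lambda> \<longleftrightarrow> (\<exists>K d. finite K \<and> K \<subseteq> S \<and> (\<forall>g. \<Lambda> g = (\<Sum>r\<in>K. d r * g r)))"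

lemma finite_functional_eval: "t \<in> S \<Longrightarrow> finite_functional S (\<lambda>g. a * g t)"
  unfolding finite_functional_def by (intro exI[of _ "{t}"] exI[of _ "\<lambda>_. a"]) auto

lemma finite_functional_add:
  assumes "finite_functional S \<Lambda>" "finite_functional S \<Gamma>"
  shows "finite_functional S (\<lambda>g. \<Lambda> g + \<Gamma> g)"
proof -
  from assms obtain K d L e where
    K: "finite K" "K \<subseteq> S" "\<And>g. \<Lambda> g = (\<Sum>r\<in>K. d r * g r)" and
    L: "finite L" "L \<subseteq> S" "\<And>g. \<Gamma> g = (\<Sum>r\<in>L. e r * g r)"
    unfolding finite_functional_def by metis
  have K': "\<Lambda> g = (\<Sum>r\<in>K \<union> L. (if r \<in> K then d r else 0) * g r)" for g
    unfolding K(3) using K(1) L(1) by (intro sum.mono_neutral_cong_left) auto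
  have L': "\<Gamma> g = (\<Sum>r\<in>K \<union> L. (if r \<in> L then e r else 0) * g r)" for g
    unfolding L(3) using K(1) L(1) by (intro sum.mono_neutral_cong_left) auto
  have "\<Lambda> g + \<Gamma> g = (\<Sum>r\<in>K \<union> L. ((if r \<in> K then d r else 0) + (if r \<in> L then e r else 0)) * g r)" for g
    unfolding K' L' by (simp only: distrib_right sum.distrib)
  then show ?thesis
    unfolding finite_functional_def using K L by (intro exI[of _ "K \<union> L"] exI conjI allI) auto
qed

lemma finite_functional_scale:
  "finite_functional S \<Lambda> \<Longrightarrow> finite_functional S (\<lambda>g. a * \<Lambda> g)"
  unfolding finite_functional_def
  by (elim exE conjE, intro exI[of _ "_ :: 'a set"] exI[of _ "\<lambda>r. a * (_ :: 'a \<Rightarrow> real) r"])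
     (auto simp: sum_distrib_left mult.assoc)

lemma finite_functional_sum:
  assumes "finite I" "\<And>i. i \<in> I \<Longrightarrow> finite_functional S (\<Lambda> i)"
  shows "finite_functional S (\<lambda>g. \<Sum>i\<in>I. \<Lambda> i g)"
  using assms
proof (induction I rule: finite_induct)
  case empty
  show ?case unfolding finite_functional_def by (intro exI[of _ "{}"]) auto
qed (simp add: finite_functional_add)

lemma finite_functional_ibp_sum:
  assumes "t \<ge> 0"
  shows "finite_functional {0..} (ibp_sum n t)"
proof -
  have "finite_functional {0..} (\<lambda>g. exp t * g t +
      (\<Sum>k\<le>n. - (t / Suc n * exp (t * Suc k / Suc n)) * g (t * Suc k / Suc n)))"
    using assms by (intro finite_functional_add finite_functional_eval finite_functional_sum) auto
  also have "(\<lambda>g. exp t * g t + (\<Sum>k\<le>n. - (t / Suc n * exp (t * Suc k / Suc n)) * g (t * Suc k / Suc n))) = ibp_sum n t"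
    by (rule ext) (simp add: ibp_sum_def sum_negf sum_distrib_left mult.assoc)
  finally show ?thesis .
qed

lemma finite_functional_linear:
  assumes "finite_functional S \<Lambda>"
  shows "\<Lambda> (\<lambda>u. \<Sum>i\<in>I. c i * f i u) = (\<Sum>i\<in>I. c i * \<Lambda> (f i))"
proof -
  from assms obtain K d where K: "\<And>g. \<Lambda> g = (\<Sum>r\<in>K. d r * g r)"
    unfolding finite_functional_def by metis
  have "\<Lambda> (\<lambda>u. \<Sum>i\<in>I. c i * f i u) = (\<Sum>r\<in>K. \<Sum>i\<in>I. c i * (d r * f i r))"
    unfolding K by (simp add: sum_distrib_left ac_simps)
  also have "\<dots> = (\<Sum>i\<in>I. \<Sum>r\<in>K. c i * (d r * f i r))" by (rule sum.swap)
  finally show ?thesis unfolding K by (simp add: sum_distrib_left)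
qed

section \<open>The transform of a continuous Gaussian process\<close>

text \<open>A finite functional of a centred Gaussian process is centred normal, and its variance is the functional
applied to both arguments of the covariance.\<close>
lemma
  assumes X: "gaussian_process M T X" and mean: "\<And>t. t \<in> T \<Longrightarrow> mean_fun M X t = 0"
    and cov: "\<And>u w. u \<in> T \<Longrightarrow> w \<in> T \<Longrightarrow> cov_fun M X u w = K u w"
    and \<Lambda>: "finite_functional T \<Lambda>"
  shows finite_functional_measurable: "(\<lambda>\<omega>. \<Lambda> (\<lambda>t. X t \<omega>)) \<in> borel_measurable M"
    and finite_functional_integrable_power2: "integrable M (\<lambda>\<omega>. (\<Lambda> (\<lambda>t. X t \<omega>))\<^sup>2)"
    and finite_functional_power2: "(\<integral>\<omega>. (\<Lambda> (\<lambda>t. X t \<omega>))\<^sup>2 \<partial>M) = \<Lambda> (\<lambda>u. \<Lambda> (K u))"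
    and finite_functional_cos:
      "(\<integral>\<omega>. cos (\<theta> + \<Lambda> (\<lambda>t. X t \<omega>)) \<partial>M) = cos \<theta> * exp (- \<Lambda> (\<lambda>u. \<Lambda> (K u)) / 2)"
proof -
  from \<Lambda> obtain J d where J: "finite J" "J \<subseteq> T" and eq: "\<And>g. \<Lambda> g = (\<Sum>r\<in>J. d r * g r)"
    unfolding finite_functional_def by metis
  have "\<Lambda> (\<lambda>u. \<Lambda> (K u)) = (\<Sum>u\<in>J. \<Sum>w\<in>J. d u * d w * cov_fun M X u w)"
    unfolding eq sum_distrib_left mult.assoc
    using J by (intro sum.cong refl) (simp add: cov subset_iff)
  then show "(\<integral>\<omega>. (\<Lambda> (\<lambda>t. X t \<omega>))\<^sup>2 \<partial>M) = \<Lambda> (\<lambda>u. \<Lambda> (K u))"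
    "(\<integral>\<omega>. cos (\<theta> + \<Lambda> (\<lambda>t. X t \<omega>)) \<partial>M) = cos \<theta> * exp (- \<Lambda> (\<lambda>u. \<Lambda> (K u)) / 2)"
    using centered_gaussian_power2[OF X mean J] centered_gaussian_cos[OF X mean J] by (simp_all add: eq)
  show "(\<lambda>\<omega>. \<Lambda> (\<lambda>t. X t \<omega>)) \<in> borel_measurable M"
    unfolding eq by (rule borel_measurable_integrable[OF gaussian_process_integrable_sum[OF X J]])
  show "integrable M (\<lambda>\<omega>. (\<Lambda> (\<lambda>t. X t \<omega>))\<^sup>2)"
    unfolding eq by (rule gaussian_process_integrable_sum_power2[OF X J])
qed

lemma X_process_eq_ibp: "X_process B t \<omega> = ibp t (\<lambda>s. B s \<omega>)"
  by (simp add: X_process_def ibp_def)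

locale continuous_centered_gaussian =
  fixes M :: "'a measure" and B :: "real \<Rightarrow> 'a \<Rightarrow> real" and K :: "real \<Rightarrow> real \<Rightarrow> real"
  assumes gaussian: "gaussian_process M {0..} B"
    and mean: "\<And>t. t \<in> {0..} \<Longrightarrow> mean_fun M B t = 0"
    and cov: "\<And>u w. u \<in> {0..} \<Longrightarrow> w \<in> {0..} \<Longrightarrow> cov_fun M B u w = K u w"
    and K: "continuous_on ({0..} \<times> {0..}) (\<lambda>(u, w). K u w)"
    and paths: "\<And>\<omega>. \<omega> \<in> space M \<Longrightarrow> continuous_on {0..} (\<lambda>t. B t \<omega>)"
begin

sublocale prob_space M
  using gaussian by (simp add: gaussian_process_def)

lemma ibp_sum_tendsto_X_process:
  assumes "t \<ge> 0" "\<omega> \<in> space M"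
  shows "(\<lambda>n. ibp_sum n t (\<lambda>s. B s \<omega>)) \<longlonglongrightarrow> X_process B t \<omega>"
  unfolding X_process_eq_ibp using assms by (intro ibp_sum_tendsto_continuous paths)

lemma ibp_sum_measurable:
  assumes "t \<ge> 0"
  shows "(\<lambda>\<omega>. ibp_sum n t (\<lambda>s. B s \<omega>)) \<in> borel_measurable M"
  by (rule finite_functional_measurable[OF gaussian mean cov finite_functional_ibp_sum[OF assms]])

lemma X_process_measurable:
  assumes "t \<ge> 0"
  shows "X_process B t \<in> borel_measurable M"
  by (rule borel_measurable_LIMSEQ_real[of _ "\<lambda>n \<omega>. ibp_sum n t (\<lambda>s. B s \<omega>)"])
     (auto intro: ibp_sum_tendsto_X_process ibp_sum_measurable assms)

text \<open>Replace the integral by Riemann sums. Each resulting variable is a finite functional of \<open>B\<close> and so has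
a known cosine transform; the left-hand sides converge by dominated convergence along the continuous
paths, the variances by the convergence lemma for kernels.\<close>
lemma X_process_cos:
  assumes J: "finite J" "J \<subseteq> {0..}"
  shows "(\<integral>\<omega>. cos (\<theta> + (\<Sum>t\<in>J. c t * X_process B t \<omega>)) \<partial>M) =
    cos \<theta> * exp (- (\<Sum>t\<in>J. \<Sum>s\<in>J. c t * c s * ibp t (\<lambda>u. ibp s (K u))) / 2)"
proof -
  define \<Lambda> where "\<Lambda> n g = (\<Sum>t\<in>J. c t * ibp_sum n t g)" for n g
  have \<Lambda>: "finite_functional {0..} (\<Lambda> n)" for n
    unfolding \<Lambda>_def using J
    by (intro finite_functional_sum finite_functional_scale finite_functional_ibp_sum) auto
  have "\<Lambda> n (\<lambda>u. \<Lambda> n (K u)) = (\<Sum>t\<in>J. \<Sum>s\<in>J. c t * c s * ibp_sum n t (\<lambda>u. ibp_sum n s (K u)))" for n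
    unfolding \<Lambda>_def using J
    by (intro sum.cong refl)
       (auto simp: sum_distrib_left mult.assoc finite_functional_linear[OF finite_functional_ibp_sum])
  moreover have "(\<lambda>n. \<Sum>t\<in>J. \<Sum>s\<in>J. c t * c s * ibp_sum n t (\<lambda>u. ibp_sum n s (K u))) \<longlonglongrightarrow>
      (\<Sum>t\<in>J. \<Sum>s\<in>J. c t * c s * ibp t (\<lambda>u. ibp s (K u)))"
    using J by (intro tendsto_sum tendsto_mult tendsto_const ibp_sum_kernel_tendsto K) auto
  ultimately have var: "(\<lambda>n. \<Lambda> n (\<lambda>u. \<Lambda> n (K u))) \<longlonglongrightarrow> (\<Sum>t\<in>J. \<Sum>s\<in>J. c t * c s * ibp t (\<lambda>u. ibp s (K u)))"
    by simp
  have "(\<lambda>n. \<integral>\<omega>. cos (\<theta> + \<Lambda> n (\<lambda>s. B s \<omega>)) \<partial>M) \<longlonglongrightarrow> (\<integral>\<omega>. cos (\<theta> + (\<Sum>t\<in>J. c t * X_process B t \<omega>)) \<partial>M)"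
  proof (rule integral_dominated_convergence[where w = "\<lambda>_. 1"])
    have [measurable]: "(\<lambda>\<omega>. \<Lambda> n (\<lambda>s. B s \<omega>)) \<in> borel_measurable M" for n
      by (rule finite_functional_measurable[OF gaussian mean cov \<Lambda>])
    show "(\<lambda>\<omega>. cos (\<theta> + \<Lambda> n (\<lambda>s. B s \<omega>))) \<in> borel_measurable M" for n
      by measurable
    have "(\<lambda>\<omega>. \<Sum>t\<in>J. c t * X_process B t \<omega>) \<in> borel_measurable M"
      using J by (intro borel_measurable_sum borel_measurable_times) (auto intro: X_process_measurable)
    then show "(\<lambda>\<omega>. cos (\<theta> + (\<Sum>t\<in>J. c t * X_process B t \<omega>))) \<in> borel_measurable M"
      by measurable
    have "(\<lambda>n. cos (\<theta> + \<Lambda> n (\<lambda>s. B s \<omega>))) \<longlonglongrightarrow> cos (\<theta> + (\<Sum>t\<in>J. c t * X_process B t \<omega>))"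
      if "\<omega> \<in> space M" for \<omega>
      unfolding \<Lambda>_def using J that by (intro tendsto_intros ibp_sum_tendsto_X_process) auto
    then show "AE \<omega> in M. (\<lambda>n. cos (\<theta> + \<Lambda> n (\<lambda>s. B s \<omega>))) \<longlonglongrightarrow> cos (\<theta> + (\<Sum>t\<in>J. c t * X_process B t \<omega>))"
      by (rule AE_I2)
  qed auto
  moreover have "(\<lambda>n. cos \<theta> * exp (- \<Lambda> n (\<lambda>u. \<Lambda> n (K u)) / 2)) \<longlonglongrightarrow>
      cos \<theta> * exp (- (\<Sum>t\<in>J. \<Sum>s\<in>J. c t * c s * ibp t (\<lambda>u. ibp s (K u))) / 2)"
    by (intro tendsto_intros var) auto
  moreover have "(\<integral>\<omega>. cos (\<theta> + \<Lambda> n (\<lambda>s. B s \<omega>)) \<partial>M) = cos \<theta> * exp (- \<Lambda> n (\<lambda>u. \<Lambda> n (K u)) / 2)" for n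
    by (rule finite_functional_cos[OF gaussian mean cov \<Lambda>])
  ultimately show ?thesis
    by (auto intro: LIMSEQ_unique)
qed

text \<open>Fatou's lemma along the Riemann sums. An upper bound is all that is needed of the second moments,
because they only serve to control the tails.\<close>
lemma
  assumes t: "t \<ge> 0"
  shows X_process_integrable_power2: "integrable M (\<lambda>\<omega>. (X_process B t \<omega>)\<^sup>2)"
    and X_process_power2_le: "(\<integral>\<omega>. (X_process B t \<omega>)\<^sup>2 \<partial>M) \<le> ibp t (\<lambda>u. ibp t (K u))"
proof -
  let ?S = "\<lambda>n \<omega>. ibp_sum n t (\<lambda>s. B s \<omega>)" and ?V = "ibp t (\<lambda>u. ibp t (K u))"
  note fin = finite_functional_ibp_sum[OF t]
  note [measurable] = X_process_measurable[OF t] ibp_sum_measurable[OF t]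
  have lim: "(\<lambda>n. ibp_sum n t (\<lambda>u. ibp_sum n t (K u))) \<longlonglongrightarrow> ?V"
    by (rule ibp_sum_kernel_tendsto[OF t t K])
  have S2: "(\<integral>\<^sup>+\<omega>. ennreal ((?S n \<omega>)\<^sup>2) \<partial>M) = ennreal (ibp_sum n t (\<lambda>u. ibp_sum n t (K u)))" for n
    using finite_functional_power2[OF gaussian mean cov fin[of n]]
    by (subst nn_integral_eq_integral[OF finite_functional_integrable_power2[OF gaussian mean cov fin]]) auto
  have "0 \<le> ibp_sum n t (\<lambda>u. ibp_sum n t (K u))" for n
    using finite_functional_power2[OF gaussian mean cov fin[of n], symmetric] by simp
  with lim have "0 \<le> ?V" by (intro LIMSEQ_le_const) auto
  have "(\<integral>\<^sup>+\<omega>. ennreal ((X_process B t \<omega>)\<^sup>2) \<partial>M) = (\<integral>\<^sup>+\<omega>. liminf (\<lambda>n. ennreal ((?S n \<omega>)\<^sup>2)) \<partial>M)"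
  proof (rule nn_integral_cong)
    fix \<omega> assume "\<omega> \<in> space M"
    then have "(\<lambda>n. ennreal ((?S n \<omega>)\<^sup>2)) \<longlonglongrightarrow> ennreal ((X_process B t \<omega>)\<^sup>2)"
      by (intro tendsto_ennrealI tendsto_power ibp_sum_tendsto_X_process t)
    then show "ennreal ((X_process B t \<omega>)\<^sup>2) = liminf (\<lambda>n. ennreal ((?S n \<omega>)\<^sup>2))"
      by (rule lim_imp_Liminf[OF sequentially_bot, symmetric])
  qed
  also have "\<dots> \<le> liminf (\<lambda>n. \<integral>\<^sup>+\<omega>. ennreal ((?S n \<omega>)\<^sup>2) \<partial>M)"
    by (rule nn_integral_liminf) measurable
  also have "\<dots> = ennreal ?V"
    unfolding S2 by (intro lim_imp_Liminf tendsto_ennrealI lim) simp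
  finally have le: "(\<integral>\<^sup>+\<omega>. ennreal ((X_process B t \<omega>)\<^sup>2) \<partial>M) \<le> ennreal ?V" .
  show int: "integrable M (\<lambda>\<omega>. (X_process B t \<omega>)\<^sup>2)"
    by (rule integrableI_bounded) (use le in \<open>auto simp: less_top[symmetric] top_unique\<close>)
  show "(\<integral>\<omega>. (X_process B t \<omega>)\<^sup>2 \<partial>M) \<le> ?V"
    using le \<open>0 \<le> ?V\<close> by (subst (asm) nn_integral_eq_integral[OF int]) auto
qed

end

section \<open>The limit of the covariance functions\<close>

definition fbm_cov :: "real \<Rightarrow> real \<Rightarrow> real \<Rightarrow> real" where
  "fbm_cov H t s = (t powr (2 * H) + s powr (2 * H) - \<bar>t - s\<bar> powr (2 * H)) / 2"

lemma fbm_cov_continuous: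
  assumes "H > 0"
  shows "continuous_on ({0..} \<times> {0..}) (\<lambda>(u, w). fbm_cov H u w)"
  unfolding fbm_cov_def case_prod_beta using assms
  by (intro continuous_intros continuous_on_powr') auto

lemma continuous_centered_gaussian_fbm:
  assumes "fractional_brownian_motion H M B"
  shows "continuous_centered_gaussian M B (fbm_cov H)"
proof
  show "continuous_on ({0..} \<times> {0..}) (\<lambda>(u, w). fbm_cov H u w)"
    using assms by (intro fbm_cov_continuous) (simp add: fractional_brownian_motion_def)
qed (use assms in \<open>simp_all add: fractional_brownian_motion_def fbm_cov_def\<close>)

lemma fbm_cov_bound:
  assumes "0 < H" "H < 1 / 2" "u \<in> {0..T}" "w \<in> {0..T}"
  shows "\<bar>fbm_cov H u w\<bar> \<le> 2 * (1 + T)"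
proof -
  have p: "0 \<le> x powr (2 * H)" "x powr (2 * H) \<le> 1 + T" if "0 \<le> x" "x \<le> T" for x
  proof -
    show "x powr (2 * H) \<le> 1 + T"
    proof (cases "x \<le> 1")
      case True
      then have "x powr (2 * H) \<le> 1" using that assms by (intro powr_le1) auto
      then show ?thesis using that by linarith
    next
      case False
      then have "x powr (2 * H) \<le> x powr 1" using assms by (intro powr_mono) auto
      then show ?thesis using that by simp
    qed
  qed simp
  have "0 \<le> u" "u \<le> T" "0 \<le> w" "w \<le> T" "\<bar>u - w\<bar> \<le> T" using assms by auto
  moreover have "\<bar>(a + b - c) / 2\<bar> \<le> 2 * (1 + T)"
    if "0 \<le> a" "a \<le> 1 + T" "0 \<le> b" "b \<le> 1 + T" "0 \<le> c" "c \<le> 1 + T" for a b c :: real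
    using that by (simp add: abs_le_iff)
  ultimately show ?thesis
    unfolding fbm_cov_def using p by simp
qed

text \<open>The covariance of a process that is \<open>0\<close> at time \<open>0\<close> and \<open>(\<xi>\<^sub>t + \<eta>) / \<surd>2\<close> at each \<open>t > 0\<close>, with independent
standard normal \<open>\<eta>\<close> and \<open>\<xi>\<^sub>t\<close>: white noise plus a common component.\<close>
definition fbm_cov0 :: "real \<Rightarrow> real \<Rightarrow> real" where
  "fbm_cov0 t s = (if min t s = 0 then 0 else if t = s then 1 else 1 / 2)"

lemma fbm_cov_tendsto:
  assumes "H \<longlonglongrightarrow> 0" "u \<ge> 0" "w \<ge> 0"
  shows "(\<lambda>n. fbm_cov (H n) u w) \<longlonglongrightarrow> fbm_cov0 u w"
proof -
  have p: "(\<lambda>n. x powr (2 * H n)) \<longlonglongrightarrow> (if x = 0 then 0 else 1)" for x :: real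
  proof (cases "x = 0")
    case False
    have "(\<lambda>n. x powr (2 * H n)) \<longlonglongrightarrow> x powr (2 * 0)"
      using False by (intro tendsto_powr tendsto_intros assms(1))
    then show ?thesis using False by simp
  qed simp
  have "(\<lambda>n. fbm_cov (H n) u w) \<longlonglongrightarrow>
      ((if u = 0 then 0 else 1) + (if w = 0 then 0 else 1) - (if \<bar>u - w\<bar> = 0 then 0 else 1)) / 2"
    unfolding fbm_cov_def by (intro tendsto_divide tendsto_diff tendsto_add p tendsto_const) simp
  also have "((if u = 0 then 0 else 1) + (if w = 0 then 0 else 1) - (if \<bar>u - w\<bar> = 0 then 0 else 1)) / 2 = fbm_cov0 u w"
    using assms(2,3) by (auto simp: fbm_cov0_def min_def)
  finally show ?thesis .
qed

lemma ibp_tendsto: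
  assumes t: "t \<ge> 0"
    and int: "\<And>n. (\<lambda>s. exp s * g n s) integrable_on {0..t}"
    and bound: "\<And>n x. x \<in> {0..t} \<Longrightarrow> \<bar>g n x\<bar> \<le> C"
    and conv: "\<And>x. x \<in> {0..t} \<Longrightarrow> (\<lambda>n. g n x) \<longlonglongrightarrow> l x"
  shows "(\<lambda>n. ibp t (g n)) \<longlonglongrightarrow> ibp t l"
proof -
  have "(\<lambda>n. integral {0..t} (\<lambda>s. exp s * g n s)) \<longlonglongrightarrow> integral {0..t} (\<lambda>s. exp s * l s)"
  proof (rule dominated_convergence(2)[OF int])
    show "norm (exp x * g n x) \<le> exp t * C" if "x \<in> {0..t}" for n x
      using bound[OF that] that by (simp add: abs_mult mult_mono)
    show "(\<lambda>n. exp x * g n x) \<longlonglongrightarrow> exp x * l x" if "x \<in> {0..t}" for x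
      by (intro tendsto_intros conv that)
  qed auto
  then show ?thesis
    unfolding ibp_def using t by (intro tendsto_intros conv) auto
qed

lemma ibp_bound:
  assumes t: "t \<ge> 0"
    and int: "(\<lambda>s. exp s * g s) integrable_on {0..t}"
    and bound: "\<And>x. x \<in> {0..t} \<Longrightarrow> \<bar>g x\<bar> \<le> C"
  shows "\<bar>ibp t g\<bar> \<le> exp t * C + exp t * C * t"
proof -
  have g: "\<bar>exp x * g x\<bar> \<le> exp t * C" if "x \<in> {0..t}" for x
    using bound[OF that] that by (simp add: abs_mult mult_mono)
  have "0 \<le> exp t * C" using bound[of 0] t by force
  then have "norm (integral {0..t} (\<lambda>s. exp s * g s)) \<le> exp t * C * measure lborel {0..t}"
    by (rule has_integral_bound_real[OF _ finite.emptyI integrable_integral[OF int]]) (use g in auto)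
  then have "\<bar>integral {0..t} (\<lambda>s. exp s * g s)\<bar> \<le> exp t * C * t" using t by simp
  moreover have "\<bar>exp t * g t\<bar> \<le> exp t * C" using g t by auto
  ultimately show ?thesis unfolding ibp_def by linarith
qed

text \<open>The integral cannot see finitely many points, so the value \<open>g t\<close> matters only through the boundary term.
For the limiting covariance this annihilates the white noise inside the integral and keeps it in the
boundary term.\<close>
lemma ibp_eq_const_except_finite:
  assumes "t \<ge> 0" "finite F" "\<And>x. x \<in> {0..t} - F \<Longrightarrow> g x = a"
  shows "ibp t g = exp t * (g t - a) + a"
proof -
  have "((\<lambda>s. exp s * a) has_integral (exp t * a - exp 0 * a)) {0..t}"
    using assms(1) by (intro fundamental_theorem_of_calculus)
      (auto intro!: derivative_eq_intros simp flip: has_real_derivative_iff_has_vector_derivative)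
  then have "((\<lambda>s. exp s * g s) has_integral (exp t * a - exp 0 * a)) {0..t}"
    by (rule has_integral_spike_finite[OF assms(2), rotated]) (use assms(3) in auto)
  then show ?thesis unfolding ibp_def by (simp add: integral_unique algebra_simps)
qed

lemma ibp_fbm_cov0:
  assumes "t \<ge> 0" "s \<ge> 0"
  shows "ibp t (\<lambda>u. ibp s (fbm_cov0 u)) = R0 t s"
proof -
  have inner: "ibp s (fbm_cov0 u) = (if u = 0 then 0 else exp s * (fbm_cov0 u s - 1 / 2) + 1 / 2)" if "u \<ge> 0" for u
  proof (cases "u = 0")
    case True
    then show ?thesis
      using ibp_eq_const_except_finite[of s "{}" "fbm_cov0 u" 0] assms(2) by (simp add: fbm_cov0_def min_def)
  next
    case False
    have "ibp s (fbm_cov0 u) = exp s * (fbm_cov0 u s - 1 / 2) + 1 / 2"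
      using assms(2) that False
      by (intro ibp_eq_const_except_finite[where F = "{0, u}"]) (auto simp: fbm_cov0_def min_def)
    then show ?thesis using False by simp
  qed
  show ?thesis
  proof (cases "s = 0")
    case True
    have zero: "ibp s (fbm_cov0 u) = 0" if "u \<ge> 0" for u
      using inner[OF that] that True by (simp add: fbm_cov0_def min_def)
    have "ibp t (\<lambda>u. ibp s (fbm_cov0 u)) = exp t * (ibp s (fbm_cov0 t) - 0) + 0"
      using assms(1) by (intro ibp_eq_const_except_finite[where F = "{}"]) (simp_all add: zero)
    then show ?thesis using assms True zero[of t] by (simp add: R0_def min_def)
  next
    case False
    have "ibp t (\<lambda>u. ibp s (fbm_cov0 u)) = exp t * (ibp s (fbm_cov0 t) - 1 / 2) + 1 / 2"
      using assms False
      by (intro ibp_eq_const_except_finite[where F = "{0, s}"]) (auto simp: inner fbm_cov0_def min_def)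
    moreover have "exp (s * 2) = exp s * exp s"
      by (simp add: mult_exp_exp)
    ultimately show ?thesis
      using assms False
      by (auto simp: inner fbm_cov0_def R0_def min_def field_simps)
  qed
qed

text \<open>The covariance of fractional Brownian motion converges at every pair of times, but not uniformly, since
the limit is discontinuous. Being bounded on compact sets, it allows dominated convergence, first in the
inner integral and then in the outer one.\<close>
lemma X_process_cov_tendsto:
  assumes t: "t \<ge> 0" and s: "s \<ge> 0"
  shows "((\<lambda>H. ibp t (\<lambda>u. ibp s (fbm_cov H u))) \<longlongrightarrow> R0 t s) (at_right 0)"
proof (rule tendsto_at_right_sequentially[of 0 "1 / 2"])
  fix H :: "nat \<Rightarrow> real"
  assume H: "\<And>n. 0 < H n" "\<And>n. H n < 1 / 2" "H \<longlonglongrightarrow> 0"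
  \<comment> \<open>For \<open>0 < 2H < 1\<close> one has \<open>x\<^bsup>2H\<^esup> \<le> 1 + x\<close>, a bound independent of \<open>H\<close>.\<close>
  define C where "C = 2 * (1 + max t s)"
  have bound: "\<bar>fbm_cov (H n) u w\<bar> \<le> C" if "u \<in> {0..t}" "w \<in> {0..s}" for n u w
    unfolding C_def using that by (intro fbm_cov_bound H) auto
  have int: "(\<lambda>w. exp w * fbm_cov (H n) u w) integrable_on {0..s}" if "u \<in> {0..t}" for n u
  proof (rule integrable_continuous_real)
    have "continuous_on {0..s} (\<lambda>w. (\<lambda>(u, w). fbm_cov (H n) u w) (u, w))"
      by (rule continuous_on_compose2[OF fbm_cov_continuous[OF H(1)[of n]]])
         (use that in \<open>auto intro!: continuous_intros\<close>)
    then show "continuous_on {0..s} (\<lambda>w. exp w * fbm_cov (H n) u w)"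
      by (intro continuous_intros) simp
  qed
  show "(\<lambda>n. ibp t (\<lambda>u. ibp s (fbm_cov (H n) u))) \<longlonglongrightarrow> R0 t s"
    unfolding ibp_fbm_cov0[OF t s, symmetric]
  proof (rule ibp_tendsto[OF t])
    show "(\<lambda>u. exp u * ibp s (fbm_cov (H n) u)) integrable_on {0..t}" for n
      by (rule ibp_kernel_integrable[OF t s fbm_cov_continuous[OF H(1)]])
    show "\<bar>ibp s (fbm_cov (H n) u)\<bar> \<le> exp s * C + exp s * C * s" if "u \<in> {0..t}" for n u
      by (rule ibp_bound[OF s int[OF that] bound[OF that]])
    show "(\<lambda>n. ibp s (fbm_cov (H n) u)) \<longlonglongrightarrow> ibp s (fbm_cov0 u)" if "u \<in> {0..t}" for u
      by (rule ibp_tendsto[OF s int[OF that] bound[OF that]])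
         (use that in \<open>auto intro!: fbm_cov_tendsto H(3)\<close>)
  qed
qed simp

section \<open>The limit process\<close>

definition iid_normal :: "('i \<Rightarrow> real) measure" where
  "iid_normal = PiM UNIV (\<lambda>_. std_normal_distribution)"

lemma prob_space_iid_normal: "prob_space iid_normal"
  unfolding iid_normal_def by (intro prob_space_PiM prob_space_normal_density) simp

lemma iid_normal_coordinate_measurable [measurable]: "(\<lambda>\<omega>. \<omega> i) \<in> borel_measurable iid_normal"
proof -
  have "(\<lambda>\<omega>. \<omega> i) \<in> measurable iid_normal std_normal_distribution"
    unfolding iid_normal_def by (rule measurable_component_singleton) simp
  then show ?thesis by (simp cong: measurable_cong_sets)
qed

lemma distr_iid_normal_coordinate: "distr iid_normal borel (\<lambda>\<omega>. \<omega> i) = std_normal_distribution"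
proof -
  have "distr iid_normal std_normal_distribution (\<lambda>\<omega>. \<omega> i) = std_normal_distribution"
    unfolding iid_normal_def by (intro distr_PiM_component prob_space_normal_density) simp_all
  moreover have "distr iid_normal std_normal_distribution (\<lambda>\<omega>. \<omega> i) = distr iid_normal borel (\<lambda>\<omega>. \<omega> i)"
    by (rule distr_cong) simp_all
  ultimately show ?thesis by simp
qed

lemma indep_vars_iid_normal:
  "prob_space.indep_vars iid_normal (\<lambda>_. borel) (\<lambda>i \<omega>. \<omega> i) UNIV"
proof -
  interpret prob_space "iid_normal :: ('a \<Rightarrow> real) measure" by (rule prob_space_iid_normal)
  have "distr iid_normal (PiM UNIV (\<lambda>_. borel)) (\<lambda>\<omega>. \<lambda>i\<in>UNIV. \<omega> i) =
      distr (iid_normal :: ('a \<Rightarrow> real) measure) (PiM UNIV (\<lambda>_. borel)) (\<lambda>\<omega>. \<omega>)"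
    by (rule distr_cong) (simp_all add: restrict_UNIV)
  also have "\<dots> = iid_normal"
  proof (rule distr_id2)
    show "sets (PiM UNIV (\<lambda>_. borel)) = sets (iid_normal :: ('a \<Rightarrow> real) measure)"
      unfolding iid_normal_def by (intro sets_PiM_cong) simp_all
  qed
  also have "\<dots> = PiM UNIV (\<lambda>i. distr iid_normal borel (\<lambda>\<omega>. \<omega> i))"
    unfolding distr_iid_normal_coordinate by (rule iid_normal_def)
  finally show ?thesis
    by (subst indep_vars_iff_distr_eq_PiM') (auto simp: iid_normal_coordinate_measurable)
qed

lemma distr_sum_iid_normal:
  assumes "finite I"
  shows "distr iid_normal borel (\<lambda>\<omega>. \<Sum>i\<in>I. d i * \<omega> i) = normal_law 0 (sqrt (\<Sum>i\<in>I. (d i)\<^sup>2))"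
proof -
  interpret prob_space "iid_normal :: ('a \<Rightarrow> real) measure" by (rule prob_space_iid_normal)
  \<comment> \<open>Only nonzero coefficients give summands with a density.\<close>
  define I' where "I' = {i \<in> I. d i \<noteq> 0}"
  have I': "finite I'" using assms by (simp add: I'_def)
  have sum_eq: "(\<Sum>i\<in>I. d i * \<omega> i) = (\<Sum>i\<in>I'. d i * \<omega> i)" for \<omega>
    unfolding I'_def using assms by (intro sum.mono_neutral_right) auto
  have sq_eq: "(\<Sum>i\<in>I. (d i)\<^sup>2) = (\<Sum>i\<in>I'. (d i)\<^sup>2)"
    unfolding I'_def using assms by (intro sum.mono_neutral_right) auto
  show ?thesis
  proof (cases "I' = {}")
    case True
    then show ?thesis unfolding sum_eq sq_eq by (simp add: normal_law_def distr_const)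
  next
    case False
    have pos: "0 < (\<Sum>i\<in>I'. (d i)\<^sup>2)"
      using False I' by (intro sum_pos) (auto simp: I'_def)
    have std: "distributed iid_normal lborel (\<lambda>\<omega>. \<omega> i) std_normal_density" for i :: 'a
    proof -
      have "distr iid_normal lborel (\<lambda>\<omega>. \<omega> i) = distr iid_normal borel (\<lambda>\<omega>. \<omega> i)"
        by (rule distr_cong) simp_all
      then show ?thesis
        by (simp add: distributed_def distr_iid_normal_coordinate)
    qed
    have "distributed iid_normal lborel (\<lambda>\<omega>. \<Sum>i\<in>I'. d i * \<omega> i)
        (normal_density (\<Sum>i\<in>I'. 0) (sqrt (\<Sum>i\<in>I'. \<bar>d i\<bar>\<^sup>2)))"
    proof (rule sum_indep_normal[OF I' False])
      show "indep_vars (\<lambda>i. borel) (\<lambda>i \<omega>. d i * \<omega> i) I'"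
        by (rule indep_vars_compose2[OF indep_vars_subset[OF indep_vars_iid_normal subset_UNIV]]) simp
      show "0 < \<bar>d i\<bar>" if "i \<in> I'" for i using that by (simp add: I'_def)
      show "distributed iid_normal lborel (\<lambda>\<omega>. d i * \<omega> i) (normal_density 0 \<bar>d i\<bar>)" if "i \<in> I'" for i
        using normal_density_affine[OF std, of "d i" 0] that by (simp add: I'_def)
    qed
    from distributed_distr_eq_density[OF this]
    have "distr iid_normal lborel (\<lambda>\<omega>. \<Sum>i\<in>I'. d i * \<omega> i)
        = density lborel (normal_density 0 (sqrt (\<Sum>i\<in>I'. (d i)\<^sup>2)))" by simp
    moreover have "distr iid_normal lborel (\<lambda>\<omega>. \<Sum>i\<in>I'. d i * \<omega> i) = distr iid_normal borel (\<lambda>\<omega>. \<Sum>i\<in>I'. d i * \<omega> i)"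
      by (rule distr_cong) simp_all
    ultimately show ?thesis
      unfolding sum_eq sq_eq using pos by (simp add: normal_law_def)
  qed
qed

lemma gaussian_process_finite_functionals:
  fixes \<Lambda> :: "'t \<Rightarrow> ('i \<Rightarrow> real) \<Rightarrow> real"
  assumes "\<And>t. t \<in> T \<Longrightarrow> finite_functional UNIV (\<Lambda> t)"
  shows "gaussian_process iid_normal T \<Lambda>"
  unfolding gaussian_process_def
proof (intro conjI allI impI ballI prob_space_iid_normal)
  fix t assume "t \<in> T"
  from assms[OF this] obtain I d where "\<And>\<omega>. \<Lambda> t \<omega> = (\<Sum>i\<in>I. d i * \<omega> i)"
    unfolding finite_functional_def by metis
  then have "\<Lambda> t = (\<lambda>\<omega>. \<Sum>i\<in>I. d i * \<omega> i)" by blast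
  then show "\<Lambda> t \<in> borel_measurable iid_normal" by simp
next
  fix J and c :: "'t \<Rightarrow> real" assume J: "finite J \<and> J \<subseteq> T"
  then have "finite_functional UNIV (\<lambda>\<omega>. \<Sum>t\<in>J. c t * \<Lambda> t \<omega>)"
    by (intro finite_functional_sum finite_functional_scale assms) auto
  then obtain I d where "finite I" "\<And>\<omega>. (\<Sum>t\<in>J. c t * \<Lambda> t \<omega>) = (\<Sum>i\<in>I. d i * \<omega> i)"
    unfolding finite_functional_def by metis
  then have "distr iid_normal borel (\<lambda>\<omega>. \<Sum>t\<in>J. c t * \<Lambda> t \<omega>) = normal_law 0 (sqrt (\<Sum>i\<in>I. (d i)\<^sup>2))"
    by (simp add: distr_sum_iid_normal)
  then show "\<exists>\<mu> \<sigma>. \<sigma> \<ge> 0 \<and> distr iid_normal borel (\<lambda>\<omega>. \<Sum>t\<in>J. c t * \<Lambda> t \<omega>) = normal_law \<mu> \<sigma>"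
    by (intro exI conjI) (auto intro: sum_nonneg)
qed

text \<open>All moments come from the law of a finite sum of coordinates; for \<open>i \<noteq> j\<close> the covariance is obtained by
comparing the variance \<open>2\<close> of \<open>\<omega> i + \<omega> j\<close> with those of its summands.\<close>
lemma
  shows iid_normal_integrable: "integrable iid_normal (\<lambda>\<omega>. \<omega> i)"
    and iid_normal_integrable_mult: "integrable iid_normal (\<lambda>\<omega>. \<omega> i * \<omega> j)"
    and iid_normal_mean: "(\<integral>\<omega>. \<omega> i \<partial>iid_normal) = 0"
    and iid_normal_cov: "(\<integral>\<omega>. \<omega> i * \<omega> j \<partial>iid_normal) = (if i = j then 1 else 0)"
proof -
  have coord: "gaussian_process iid_normal UNIV (\<lambda>i \<omega>. \<omega> i)"
    using finite_functional_eval[of _ UNIV 1] by (intro gaussian_process_finite_functionals) simp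
  show i1: "integrable iid_normal (\<lambda>\<omega>. \<omega> i)" for i :: 'a
    by (rule gaussian_process_integrable[OF coord UNIV_I])
  show i2: "integrable iid_normal (\<lambda>\<omega>. \<omega> i * \<omega> j)" for i j :: 'a
    by (rule gaussian_process_integrable_mult[OF coord UNIV_I UNIV_I])
  have law: "(\<integral>\<omega>. h (\<Sum>i\<in>I. \<omega> i) \<partial>iid_normal) = (\<integral>x. h x \<partial>normal_law 0 (sqrt (card I)))"
    if "finite I" "h \<in> borel_measurable borel" for h :: "real \<Rightarrow> real" and I :: "'a set"
  proof -
    have "(\<integral>\<omega>. h (\<Sum>i\<in>I. \<omega> i) \<partial>iid_normal) = (\<integral>x. h x \<partial>distr iid_normal borel (\<lambda>\<omega>. \<Sum>i\<in>I. \<omega> i))"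
      using that(2) by (subst integral_distr) auto
    then show ?thesis
      using distr_sum_iid_normal[OF that(1), of "\<lambda>_. 1"] by simp
  qed
  show "(\<integral>\<omega>. \<omega> i \<partial>iid_normal) = 0"
    using law[of "{i}" "\<lambda>x. x"] by (simp add: integral_normal_law)
  have var: "(\<integral>\<omega>. \<omega> i * \<omega> i \<partial>iid_normal) = 1" for i :: 'a
    using law[of "{i}" "\<lambda>x. x\<^sup>2"] integral_normal_law_power2[of 1 0] by (simp add: power2_eq_square)
  show "(\<integral>\<omega>. \<omega> i * \<omega> j \<partial>iid_normal) = (if i = j then 1 else 0)"
  proof (cases "i = j")
    case False
    have "(\<integral>\<omega>. (\<omega> i + \<omega> j)\<^sup>2 \<partial>iid_normal) = 2"
      using law[of "{i, j}" "\<lambda>x. x\<^sup>2"] False by (simp add: integral_normal_law_power2)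
    moreover have "(\<integral>\<omega>. (\<omega> i + \<omega> j)\<^sup>2 \<partial>iid_normal) =
        (\<integral>\<omega>. \<omega> i * \<omega> i + \<omega> j * \<omega> j + 2 * (\<omega> i * \<omega> j) \<partial>iid_normal)"
      by (simp add: power2_eq_square algebra_simps)
    moreover have "\<dots> = (\<integral>\<omega>. \<omega> i * \<omega> i \<partial>iid_normal) + (\<integral>\<omega>. \<omega> j * \<omega> j \<partial>iid_normal) + 2 * (\<integral>\<omega>. \<omega> i * \<omega> j \<partial>iid_normal)"
      by (simp add: i2)
    ultimately show ?thesis using False by (simp add: var)
  qed (simp add: var)
qed

text \<open>At positive times this is the limit in law suggested by \<open>e\<^sup>t B\<^sub>t - \<integral>\<^sub>0\<^sup>t e\<^sup>s B\<^sub>s ds\<close> for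
\<open>B\<^sub>t = (\<xi>\<^sub>t + \<eta>) / \<surd>2\<close>: the common part contributes \<open>(e\<^sup>t - (e\<^sup>t - 1)) \<eta> = \<eta>\<close>, and the noise \<open>\<xi>\<close>
averages out under the integral. Coordinate \<open>0\<close> is free to carry \<open>\<eta>\<close>, because the process vanishes at
time \<open>0\<close>.\<close>
definition limit_process :: "real \<Rightarrow> (real \<Rightarrow> real) \<Rightarrow> real" where
  "limit_process t \<omega> = (if t = 0 then 0 else (exp t * \<omega> t + \<omega> 0) / sqrt 2)"

lemma gaussian_limit_process: "gaussian_process iid_normal {0..} limit_process"
proof (rule gaussian_process_finite_functionals)
  fix t
  have "finite_functional UNIV (\<lambda>\<omega> :: real \<Rightarrow> real. (if t = 0 then 0 else exp t / sqrt 2) * \<omega> t + (if t = 0 then 0 else 1 / sqrt 2) * \<omega> 0)"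
    by (intro finite_functional_add finite_functional_eval UNIV_I)
  also have "(\<lambda>\<omega> :: real \<Rightarrow> real. (if t = 0 then 0 else exp t / sqrt 2) * \<omega> t + (if t = 0 then 0 else 1 / sqrt 2) * \<omega> 0) = limit_process t"
    by (rule ext) (simp add: limit_process_def add_divide_distrib)
  finally show "finite_functional UNIV (limit_process t)" .
qed

lemma mean_limit_process: "mean_fun iid_normal limit_process t = 0"
  by (cases "t = 0") (simp_all add: mean_fun_def limit_process_def iid_normal_integrable iid_normal_mean)

lemma cov_limit_process:
  assumes "t \<ge> 0" "s \<ge> 0"
  shows "cov_fun iid_normal limit_process t s = R0 t s"
proof (cases "t = 0 \<or> s = 0")
  case True
  then show ?thesis using assms by (auto simp: cov_fun_def mean_limit_process limit_process_def R0_def min_def)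
next
  case False
  have "cov_fun iid_normal limit_process t s = (\<integral>\<omega>. limit_process t \<omega> * limit_process s \<omega> \<partial>iid_normal)"
    by (simp add: cov_fun_def mean_limit_process)
  also have "\<dots> = (\<integral>\<omega>. (exp t * exp s / 2) * (\<omega> t * \<omega> s) + (exp t / 2) * (\<omega> t * \<omega> 0)
      + (exp s / 2) * (\<omega> s * \<omega> 0) + (1 / 2) * (\<omega> 0 * \<omega> 0) \<partial>iid_normal)"
    using False by (intro Bochner_Integration.integral_cong) (simp_all add: limit_process_def field_simps)
  also have "\<dots> = (exp t * exp s / 2) * (if t = s then 1 else 0) + 1 / 2"
    using False by (simp add: iid_normal_integrable_mult iid_normal_cov)
  also have "\<dots> = R0 t s"
    using False assms by (auto simp: R0_def min_def mult_exp_exp add_divide_distrib)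
  finally show ?thesis .
qed

section \<open>Convergence of the finite-dimensional distributions\<close>

lemma
  assumes "finite J" "\<And>t. t \<in> J \<Longrightarrow> X t \<in> borel_measurable M"
  shows fidi_measurable: "(\<lambda>\<omega>. \<lambda>t\<in>J. X t \<omega>) \<in> measurable M (PiM J (\<lambda>_. borel))"
    and integral_fidi_cos: "(\<integral>x. cos (\<theta> + (\<Sum>t\<in>J. c t * x t)) \<partial>fidi M X J) = (\<integral>\<omega>. cos (\<theta> + (\<Sum>t\<in>J. c t * X t \<omega>)) \<partial>M)"
    and integrable_fidi_power2: "t \<in> J \<Longrightarrow> integrable (fidi M X J) (\<lambda>x. (x t)\<^sup>2) \<longleftrightarrow> integrable M (\<lambda>\<omega>. (X t \<omega>)\<^sup>2)"
    and integral_fidi_power2: "t \<in> J \<Longrightarrow> (\<integral>x. (x t)\<^sup>2 \<partial>fidi M X J) = (\<integral>\<omega>. (X t \<omega>)\<^sup>2 \<partial>M)"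
proof -
  show m: "(\<lambda>\<omega>. \<lambda>t\<in>J. X t \<omega>) \<in> measurable M (PiM J (\<lambda>_. borel))"
    using assms by (intro measurable_restrict) auto
  show "(\<integral>x. cos (\<theta> + (\<Sum>t\<in>J. c t * x t)) \<partial>fidi M X J) = (\<integral>\<omega>. cos (\<theta> + (\<Sum>t\<in>J. c t * X t \<omega>)) \<partial>M)"
    unfolding fidi_def by (subst integral_distr[OF m]) (auto intro!: Bochner_Integration.integral_cong)
  show "integrable (fidi M X J) (\<lambda>x. (x t)\<^sup>2) \<longleftrightarrow> integrable M (\<lambda>\<omega>. (X t \<omega>)\<^sup>2)" if "t \<in> J"
    unfolding fidi_def using that by (subst integrable_distr_eq[OF m]) auto
  show "(\<integral>x. (x t)\<^sup>2 \<partial>fidi M X J) = (\<integral>\<omega>. (X t \<omega>)\<^sup>2 \<partial>M)" if "t \<in> J"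
    unfolding fidi_def using that by (subst integral_distr[OF m]) auto
qed

theorem theorem2p7:
  fixes M :: "real \<Rightarrow> 'a measure"
    and B :: "real \<Rightarrow> real \<Rightarrow> 'a \<Rightarrow> real"
  assumes "\<And>H. 0 < H \<Longrightarrow> H < 1 / 2 \<Longrightarrow> fractional_brownian_motion H (M H) (B H)"
  shows "\<exists>(M0 :: (real \<Rightarrow> real) measure) (X0 :: real \<Rightarrow> (real \<Rightarrow> real) \<Rightarrow> real).
           gaussian_process M0 {0..} X0 \<and>
           (\<forall>t\<ge>0. mean_fun M0 X0 t = 0) \<and>
           (\<forall>t\<ge>0. \<forall>s\<ge>0. cov_fun M0 X0 t s = R0 t s) \<and>
           fidi_weak_conv {0..} M (\<lambda>H. X_process (B H)) M0 X0 (at_right 0)"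
proof (intro exI conjI)
  show "gaussian_process iid_normal {0..} limit_process" by (rule gaussian_limit_process)
  show "\<forall>t\<ge>0. mean_fun iid_normal limit_process t = 0" by (simp add: mean_limit_process)
  show "\<forall>t\<ge>0. \<forall>s\<ge>0. cov_fun iid_normal limit_process t s = R0 t s" by (simp add: cov_limit_process)
  show "fidi_weak_conv {0..} M (\<lambda>H. X_process (B H)) iid_normal limit_process (at_right 0)"
    unfolding fidi_weak_conv_def
  proof (intro allI impI, elim conjE)
    fix J :: "real set" assume J: "finite J" "J \<subseteq> {0..}"
    \<comment> \<open>Both sides have explicit cosine transforms, so convergence of covariances is all that is left.\<close>
    let ?\<mu> = "\<lambda>H. fidi (M H) (X_process (B H)) J" and ?\<nu> = "fidi iid_normal limit_process J"
    let ?V = "\<lambda>H t s. ibp t (\<lambda>u. ibp s (fbm_cov H u))"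
    have small: "\<forall>\<^sub>F H in at_right 0. continuous_centered_gaussian (M H) (B H) (fbm_cov H)"
      using eventually_at_right_real[of 0 "1 / 2"]
      by (rule eventually_mono) (auto intro!: continuous_centered_gaussian_fbm assms)
    have meas: "X_process (B H) t \<in> borel_measurable (M H)"
      if "continuous_centered_gaussian (M H) (B H) (fbm_cov H)" "t \<in> J" for H t
      using that J by (intro continuous_centered_gaussian.X_process_measurable) auto
    have meas0: "limit_process t \<in> borel_measurable iid_normal" if "t \<in> J" for t
      using that J by (intro gaussian_process_measurable[OF gaussian_limit_process]) auto
    show "weak_conv_on (product_topology (\<lambda>_. euclideanreal) J) ?\<mu> ?\<nu> (at_right 0)"
    proof (rule weak_conv_on_cosine[OF J(1), where C = "\<Sum>t\<in>J. \<bar>R0 t t\<bar> + 1"])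
      show "\<forall>\<^sub>F H in at_right 0. prob_space (?\<mu> H)"
        using small
      proof eventually_elim
        case (elim H)
        then interpret continuous_centered_gaussian "M H" "B H" "fbm_cov H" .
        show ?case unfolding fidi_def by (intro prob_space_distr fidi_measurable[OF J(1)] meas[OF elim])
      qed
      show "prob_space ?\<nu>"
        unfolding fidi_def
        by (intro prob_space.prob_space_distr prob_space_iid_normal fidi_measurable[OF J(1)] meas0)
      show "\<forall>\<^sub>F H in at_right 0. sets (?\<mu> H) = sets (PiM J (\<lambda>_. borel))" "sets ?\<nu> = sets (PiM J (\<lambda>_. borel))"
        by (simp_all add: fidi_def)
      show "\<forall>\<^sub>F H in at_right 0. \<forall>t\<in>J. integrable (?\<mu> H) (\<lambda>x. (x t)\<^sup>2)"
        using small
      proof eventually_elim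
        case (elim H)
        show ?case
          using J by (auto simp: integrable_fidi_power2[OF J(1) meas[OF elim]]
              intro!: continuous_centered_gaussian.X_process_integrable_power2[OF elim])
      qed
      show "\<forall>t\<in>J. integrable ?\<nu> (\<lambda>x. (x t)\<^sup>2)"
        using J by (auto simp: integrable_fidi_power2[OF J(1) meas0]
            intro!: gaussian_process_integrable_power2[OF gaussian_limit_process])
      have "\<forall>\<^sub>F H in at_right 0. ?V H t t < (\<Sum>t\<in>J. \<bar>R0 t t\<bar> + 1)" if "t \<in> J" for t
      proof -
        have "R0 t t < \<bar>R0 t t\<bar> + 1" by simp
        also have "\<dots> \<le> (\<Sum>t\<in>J. \<bar>R0 t t\<bar> + 1)"
          using J(1) that by (intro member_le_sum) auto
        finally show ?thesis
          using X_process_cov_tendsto[of t t] that J by (intro order_tendstoD) auto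
      qed
      then have "\<forall>\<^sub>F H in at_right 0. \<forall>t\<in>J. ?V H t t < (\<Sum>t\<in>J. \<bar>R0 t t\<bar> + 1)"
        using J(1) by (simp add: eventually_ball_finite)
      with small show "\<forall>\<^sub>F H in at_right 0. \<forall>t\<in>J. (\<integral>x. (x t)\<^sup>2 \<partial>?\<mu> H) \<le> (\<Sum>t\<in>J. \<bar>R0 t t\<bar> + 1)"
      proof eventually_elim
        case (elim H)
        have "(\<integral>x. (x t)\<^sup>2 \<partial>?\<mu> H) \<le> ?V H t t" if "t \<in> J" for t
          using continuous_centered_gaussian.X_process_power2_le[OF elim(1), of t] that J
          by (auto simp: integral_fidi_power2[OF J(1) meas[OF elim(1)]])
        with elim(2) show ?case by force
      qed
      fix c :: "real \<Rightarrow> real" and \<theta> :: real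
      have "((\<lambda>H. cos \<theta> * exp (- (\<Sum>t\<in>J. \<Sum>s\<in>J. c t * c s * ?V H t s) / 2)) \<longlongrightarrow>
          cos \<theta> * exp (- (\<Sum>t\<in>J. \<Sum>s\<in>J. c t * c s * R0 t s) / 2)) (at_right 0)"
        using J by (intro tendsto_intros X_process_cov_tendsto) auto
      moreover have "\<forall>\<^sub>F H in at_right 0. cos \<theta> * exp (- (\<Sum>t\<in>J. \<Sum>s\<in>J. c t * c s * ?V H t s) / 2) =
          (\<integral>x. cos (\<theta> + (\<Sum>t\<in>J. c t * x t)) \<partial>?\<mu> H)"
        using small
      proof eventually_elim
        case (elim H)
        show ?case
          by (rule trans[OF continuous_centered_gaussian.X_process_cos[OF elim J, symmetric]
                integral_fidi_cos[OF J(1) meas[OF elim], symmetric]])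
      qed
      moreover have "cos \<theta> * exp (- (\<Sum>t\<in>J. \<Sum>s\<in>J. c t * c s * R0 t s) / 2) =
          (\<integral>x. cos (\<theta> + (\<Sum>t\<in>J. c t * x t)) \<partial>?\<nu>)"
      proof -
        have "(\<Sum>t\<in>J. \<Sum>s\<in>J. c t * c s * cov_fun iid_normal limit_process t s) = (\<Sum>t\<in>J. \<Sum>s\<in>J. c t * c s * R0 t s)"
          using J by (intro sum.cong refl) (simp add: cov_limit_process subset_iff)
        then have "(\<integral>\<omega>. cos (\<theta> + (\<Sum>t\<in>J. c t * limit_process t \<omega>)) \<partial>iid_normal) =
            cos \<theta> * exp (- (\<Sum>t\<in>J. \<Sum>s\<in>J. c t * c s * R0 t s) / 2)"
          using centered_gaussian_cos[OF gaussian_limit_process mean_limit_process J, where c = c and \<theta> = \<theta>] by simp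
        then show ?thesis
          using integral_fidi_cos[OF J(1) meas0, where c = c and \<theta> = \<theta>] by simp
      qed
      ultimately show "((\<lambda>H. \<integral>x. cos (\<theta> + (\<Sum>t\<in>J. c t * x t)) \<partial>?\<mu> H) \<longlongrightarrow>
          (\<integral>x. cos (\<theta> + (\<Sum>t\<in>J. c t * x t)) \<partial>?\<nu>)) (at_right 0)"
        by (auto intro: Lim_transform_eventually)
    qed
  qed
qed

end
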